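(* Let $m,n\in\mathbb{N}$ with $m\geq 3$ and let $A\in M_n$ be nonsingular and normal, with eigenvalues $\lambda_1,\ldots,\lambda_n$ (listed with multiplicity). For each $i\in\{1,\ldots,n\}$, define $k_i$ to be the largest element of $\{1,\ldots,m-2\}$ for which $$\cos\left(\frac{k_i\pi}{m-1}\right)<|\lambda_i|\leq\cos\left(\frac{(k_i-1)\pi}{m-1}\right);$$ if no such element of $\{1,\ldots,m-2\}$ exists, define $k_i:=1$. Then $d(\mathcal{K}_m(A))=k_1+\cdots+k_n$.
   Context: $M_n$ is the set of $n\times n$ complex matrices. For $A\in M_n$ and $m\ge 2$, the block upper triangular KMS matrix $\mathcal{K}_m(A)$ is the $mn\times mn$ matrix whose $(i,j)$ block ($n\times n$, $1\le i,j\le m$) is $A^{j-i}$ if $j>i$ and $0$ if $j\le i$. The zero-dilation index $d(X)$ of a square complex matrix $X$ is the largest integer $k$ such that $X$ is unitarily similar to a matrix of the form $\begin{bmatrix}0_k & *\\ * & *\end{bmatrix}$, where $0_k$ is the $k\times k$ zero matrix ($k=0$ if there is no such positive $k$). *)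

theory Defs
  imports
    Complex_Main
    "Jordan_Normal_Form.Char_Poly"
    "Jordan_Normal_Form.Schur_Decomposition"
begin

definition normal_mat :: "complex mat \<Rightarrow> bool" where
  "normal_mat A \<longleftrightarrow> square_mat A \<and> A * mat_adjoint A = mat_adjoint A * A"

text \<open>\<open>similar_mat_wit X Y U (mat_adjoint U)\<close> says that \<open>X = U Y U\<^sup>*\<close> and that
  \<open>U\<close> is unitary.\<close>

definition unitarily_similar :: "complex mat \<Rightarrow> complex mat \<Rightarrow> bool" where
  "unitarily_similar X Y \<longleftrightarrow> (\<exists>U. similar_mat_wit X Y U (mat_adjoint U))"

text \<open>For a square matrix, \<open>k = 0\<close> always satisfies the predicate below and \<open>k \<le> dim_row X\<close>,
  so the greatest element exists.\<close>

definition zero_dilation_index :: "complex mat \<Rightarrow> nat" where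
  "zero_dilation_index X = (GREATEST k. k \<le> dim_row X \<and>
     (\<exists>B C D. B \<in> carrier_mat k (dim_row X - k) \<and>
              C \<in> carrier_mat (dim_row X - k) k \<and>
              D \<in> carrier_mat (dim_row X - k) (dim_row X - k) \<and>
              unitarily_similar X (four_block_mat (0\<^sub>m k k) B C D)))"

text \<open>Indices start at 0: for \<open>n = dim_row A\<close>, row \<open>i\<close> lies in block row \<open>i div n\<close>, at
  position \<open>i mod n\<close> within the block, and likewise for columns.\<close>

definition kms_mat :: "nat \<Rightarrow> complex mat \<Rightarrow> complex mat" where
  "kms_mat m A = (let n = dim_row A in
     mat (m * n) (m * n) (\<lambda>(i, j).
       if i div n < j div n
       then (A ^\<^sub>m (j div n - i div n)) $$ (i mod n, j mod n)
       else 0))"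

text \<open>The number \<open>k\<^sub>i\<close> attached to an eigenvalue of modulus \<open>r\<close>.\<close>

definition kms_index :: "nat \<Rightarrow> real \<Rightarrow> nat" where
  "kms_index m r =
     (let K = {k \<in> {1..m - 2}. cos (real k * pi / (real m - 1)) < r \<and>
                               r \<le> cos ((real k - 1) * pi / (real m - 1))}
      in if K = {} then 1 else Max K)"

end

(*
A unitary diagonalisation of A splits the form x, y |-> y^* K_m(A) x into the n scalar forms of
K_m(lambda_a), and a diagonal unitary replaces lambda_a by r = |lambda_a|. A zero block of size k
is the same as a k-dimensional subspace on which the form vanishes identically.

With x = (I - r N) u the scalar form becomes
sum_i r u_(i+1) cnj (v_i - r v_(i+1)), the bidiagonal form of N - r on a path. The eigenvalues
cos (l pi / (m - 1)), 1 <= l <= m - 2, of the path then govern both bounds. Lower bound: the pencil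
(N - r, N^T - r) gives an explicit isotropic vector for each l with cos (l pi / (m - 1)) >= r, and
e_0 gives one more. Upper bound: on the common kernel of k linear functionals the real part of the
form is negative definite, so a larger isotropic subspace of the whole space would contain a
nonzero vector annihilated by all k_1 + ... + k_n functionals.
*)

theory Submission
  imports Defs "Jordan_Normal_Form.Spectral_Radius"
begin

section \<open>Linear systems and orthonormal families\<close>

text \<open>The zero-dilation index is not additive over direct sums: the 1 x 1 matrices 1 and -1
  have index 0, their direct sum has index 1. So an upper bound for each eigenvalue would not add up
  by itself. What adds up is negativity of the real parts: the sign is the same for all eigenvalues,
  so nothing can cancel in the sum. Behind the count is inertia: k_a is the number of nonnegative
  eigenvalues of the Hermitian part of K_m(lambda_a). In the coordinates u this part has a zero
  diagonal entry at u_0, so u_0 and u_1 span a hyperbolic plane, with one positive and one negative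
  eigenvalue. Eliminating it leaves exactly the path form on u_2, ..., u_(m-1) shifted by -r. This
  explains the m - 2 vertices, the denominator m - 1 and the extra vector e_0. The lower bound must
  reach the same count with the whole complex form equal to zero. Eigenvectors of the path only give
  a nonnegative real part, hence the pencil, whose eigenvectors annihilate the form in
  pairs.\<close>

lemma homogeneous_system:
  fixes M :: "'j \<Rightarrow> 'i \<Rightarrow> 'a::field"
  assumes "finite J" "finite I" "card J < card I"
  shows "\<exists>c. (\<exists>i\<in>I. c i \<noteq> 0) \<and> (\<forall>j\<in>J. (\<Sum>i\<in>I. M j i * c i) = 0)"
  using assms
proof (induction J arbitrary: I M rule: finite_induct)
  case empty
  then have "I \<noteq> {}" by auto
  then show ?case by (intro exI[of _ "\<lambda>_. 1"]) auto
next
  case (insert j0 J)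
  show ?case
  proof (cases "\<forall>i\<in>I. M j0 i = 0")
    case True
    have "card J < card I" using insert by simp
    from insert.IH[OF insert.prems(1) this, of M] obtain c where
      "\<exists>i\<in>I. c i \<noteq> 0" "\<forall>j\<in>J. (\<Sum>i\<in>I. M j i * c i) = 0" by blast
    then show ?thesis using True by (intro exI[of _ c]) auto
  next
    case False
    then obtain i0 where i0: "i0 \<in> I" "M j0 i0 \<noteq> 0" by blast
    have fin: "finite (I - {i0})" and crd: "card J < card (I - {i0})"
      using insert i0 by auto
    \<comment> \<open>Gaussian elimination: the pivot \<open>M j0 i0\<close> clears column
      \<open>i0\<close> from the other rows, and afterwards \<open>c' i0\<close> is chosen to solve
      row \<open>j0\<close>. All dimension counts below rest on this lemma.\<close>
    define M' where "M' j i = M j i - M j i0 * M j0 i / M j0 i0" for j i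
    from insert.IH[OF fin crd, of M'] obtain c where c: "\<exists>i\<in>I - {i0}. c i \<noteq> 0"
      "\<And>j. j \<in> J \<Longrightarrow> (\<Sum>i\<in>I - {i0}. M' j i * c i) = 0" by blast
    define s where "s = (\<Sum>i\<in>I - {i0}. M j0 i * c i)"
    define c' where "c' = c(i0 := - s / M j0 i0)"
    have split: "(\<Sum>i\<in>I. M j i * c' i) = M j i0 * (- s / M j0 i0) + (\<Sum>i\<in>I - {i0}. M j i * c i)" for j
      using insert.prems(1) i0(1) by (subst sum.remove[of _ i0]) (auto simp: c'_def intro!: sum.cong)
    have "(\<Sum>i\<in>I. M j i * c' i) = 0" if "j \<in> insert j0 J" for j
    proof (cases "j = j0")
      case True
      then show ?thesis using i0(2) by (simp only: split s_def) simp
    next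
      case False
      with that have "j \<in> J" by simp
      have "M' j i * c i = M j i * c i - M j i0 / M j0 i0 * (M j0 i * c i)" for i
        by (simp add: M'_def algebra_simps)
      with c(2)[OF \<open>j \<in> J\<close>] have "(\<Sum>i\<in>I - {i0}. M j i * c i) = M j i0 / M j0 i0 * s"
        by (simp add: s_def sum_subtractf sum_distrib_left[symmetric] del: times_divide_eq_left)
      then show ?thesis unfolding split using i0(2) by simp
    qed
    moreover have "\<exists>i\<in>I. c' i \<noteq> 0" using c(1) by (auto simp: c'_def)
    ultimately show ?thesis by blast
  qed
qed

text \<open>Vectors are functions of which only the first \<open>N\<close> values count. The index
  type is open because the final isotropic family is indexed by pairs of an eigenvalue number and a
  position.\<close>

definition lin_indep :: "nat \<Rightarrow> 'i set \<Rightarrow> ('i \<Rightarrow> nat \<Rightarrow> complex) \<Rightarrow> bool" where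
  "lin_indep N I w \<longleftrightarrow>
     (\<forall>c. (\<forall>p<N. (\<Sum>i\<in>I. c i * w i p) = 0) \<longrightarrow> (\<forall>i\<in>I. c i = 0))"

definition hinner :: "nat \<Rightarrow> (nat \<Rightarrow> complex) \<Rightarrow> (nat \<Rightarrow> complex) \<Rightarrow> complex" where
  "hinner N x y = (\<Sum>p<N. x p * cnj (y p))"

definition orthonormal_fam :: "nat \<Rightarrow> nat \<Rightarrow> (nat \<Rightarrow> nat \<Rightarrow> complex) \<Rightarrow> bool" where
  "orthonormal_fam N k q \<longleftrightarrow>
     (\<forall>a<k. \<forall>b<k. hinner N (q a) (q b) = (if a = b then 1 else 0))"

lemma hinner_sum_left: "hinner N (\<lambda>p. \<Sum>i\<in>I. c i * w i p) y = (\<Sum>i\<in>I. c i * hinner N (w i) y)"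
proof -
  have "hinner N (\<lambda>p. \<Sum>i\<in>I. c i * w i p) y = (\<Sum>p<N. \<Sum>i\<in>I. c i * w i p * cnj (y p))"
    by (simp add: hinner_def sum_distrib_right)
  also have "\<dots> = (\<Sum>i\<in>I. \<Sum>p<N. c i * w i p * cnj (y p))" by (rule sum.swap)
  finally show ?thesis by (simp add: hinner_def sum_distrib_left mult.assoc)
qed

lemma hinner_cnj: "cnj (hinner N x y) = hinner N y x"
  by (simp add: hinner_def mult.commute)

lemma hinner_self: "hinner N x x = of_real (\<Sum>p<N. (cmod (x p))\<^sup>2)"
  by (simp only: hinner_def complex_norm_square of_real_sum)

text \<open>Orthogonality to \<open>k\<close> vectors amounts to \<open>k\<close> linear equations
  in more than \<open>k\<close> coefficients, so a nonzero solution exists and only needs scaling.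
  This replaces the projection step of Gram-Schmidt.\<close>

lemma unit_vector_orthogonal:
  assumes I: "finite I" "lin_indep N I w" and k: "k < card I"
  obtains c where "hinner N (\<lambda>p. \<Sum>i\<in>I. c i * w i p) (\<lambda>p. \<Sum>i\<in>I. c i * w i p) = 1"
    "\<And>a. a < k \<Longrightarrow> hinner N (\<lambda>p. \<Sum>i\<in>I. c i * w i p) (q a) = 0"
proof -
  obtain c where c: "\<exists>i\<in>I. c i \<noteq> 0"
    "\<forall>a\<in>{..<k}. (\<Sum>i\<in>I. hinner N (w i) (q a) * c i) = 0"
    using homogeneous_system[OF _ I(1), of "{..<k}" "\<lambda>a i. hinner N (w i) (q a)"] k by auto
  define x where "x p = (\<Sum>i\<in>I. c i * w i p)" for p
  define s where "s = (\<Sum>p<N. (cmod (x p))\<^sup>2)"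
  obtain p where "p < N" "x p \<noteq> 0" using I(2) c(1) unfolding lin_indep_def x_def by blast
  then have "s > 0" unfolding s_def by (intro sum_pos2[where i = p]) auto
  define t where "t = complex_of_real (1 / sqrt s)"
  define c' where "c' i = t * c i" for i
  have x': "(\<Sum>i\<in>I. c' i * w i p) = t * x p" for p
    by (simp add: c'_def x_def sum_distrib_left mult.assoc)
  show thesis
  proof (rule that[of c'])
    have "hinner N (\<lambda>p. t * x p) (\<lambda>p. t * x p) = t * t * hinner N x x"
      by (simp add: hinner_def sum_distrib_left t_def mult_ac)
    also have "\<dots> = of_real (1 / sqrt s * (1 / sqrt s) * s)"
      by (simp only: hinner_self t_def s_def of_real_mult)
    also have "1 / sqrt s * (1 / sqrt s) * s = 1" using \<open>s > 0\<close> by (simp add: field_simps)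
    finally show "hinner N (\<lambda>p. \<Sum>i\<in>I. c' i * w i p) (\<lambda>p. \<Sum>i\<in>I. c' i * w i p) = 1"
      unfolding x' by simp
    show "hinner N (\<lambda>p. \<Sum>i\<in>I. c' i * w i p) (q a) = 0" if "a < k" for a
    proof -
      have "hinner N (\<lambda>p. t * x p) (q a) = t * hinner N x (q a)"
        by (simp add: hinner_def sum_distrib_left mult_ac)
      also have "hinner N x (q a) = 0"
        using c(2) that unfolding x_def[abs_def] hinner_sum_left by (simp add: mult.commute)
      finally show ?thesis unfolding x' by simp
    qed
  qed
qed

text \<open>Serves two purposes: with \<open>k = 0\<close> it orthonormalises \<open>w\<close>
  inside its own span, and with the standard basis as \<open>w\<close> it completes \<open>q\<close>
  to an orthonormal basis.\<close>

lemma orthonormal_fam_extend: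
  assumes q: "orthonormal_fam N k q" and I: "finite I" "lin_indep N I w" and K: "k \<le> K" "K \<le> card I"
  shows "\<exists>q'. orthonormal_fam N K q' \<and> (\<forall>a<k. q' a = q a) \<and>
    (\<forall>a\<in>{k..<K}. \<exists>c. q' a = (\<lambda>p. \<Sum>i\<in>I. c i * w i p))"
  using K
proof (induction K rule: dec_induct)
  case base
  then show ?case using q by (intro exI[of _ q]) auto
next
  case (step K)
  then obtain q' where q': "orthonormal_fam N K q'" "\<forall>a<k. q' a = q a"
    "\<forall>a\<in>{k..<K}. \<exists>c. q' a = (\<lambda>p. \<Sum>i\<in>I. c i * w i p)" by auto
  obtain c where c: "hinner N (\<lambda>p. \<Sum>i\<in>I. c i * w i p) (\<lambda>p. \<Sum>i\<in>I. c i * w i p) = 1"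
    "\<And>a. a < K \<Longrightarrow> hinner N (\<lambda>p. \<Sum>i\<in>I. c i * w i p) (q' a) = 0"
    using unit_vector_orthogonal[OF I, of K q'] step.prems by auto
  define x where "x = (\<lambda>p. \<Sum>i\<in>I. c i * w i p)"
  have "hinner N (q' a) x = 0" if "a < K" for a
    using arg_cong[OF c(2)[OF that], of cnj] by (simp add: hinner_cnj x_def)
  then have "orthonormal_fam N (Suc K) (q'(K := x))"
    using q'(1) c unfolding orthonormal_fam_def x_def[symmetric] by (auto simp: less_Suc_eq)
  moreover have "\<forall>a<k. (q'(K := x)) a = q a" using q'(2) step.hyps by auto
  moreover have "\<forall>a\<in>{k..<Suc K}. \<exists>c. (q'(K := x)) a = (\<lambda>p. \<Sum>i\<in>I. c i * w i p)"
    using q'(3) unfolding x_def by (auto simp: less_Suc_eq)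
  ultimately show ?case by blast
qed

lemma lin_indep_std_basis: "lin_indep N {..<N} (\<lambda>i p. if i = p then 1 else 0)"
proof -
  have "(\<Sum>i<N. c i * (if i = p then 1 else 0)) = c p" if "p < N" for c :: "nat \<Rightarrow> complex" and p
    using that by (subst sum.remove[of _ p]) auto
  then show ?thesis unfolding lin_indep_def by simp
qed

lemma orthonormal_fam_complete:
  assumes "orthonormal_fam N k q" "k \<le> N"
  obtains q' where "orthonormal_fam N N q'" "\<And>a. a < k \<Longrightarrow> q' a = q a"
  using orthonormal_fam_extend[OF assms(1) finite_lessThan lin_indep_std_basis assms(2)] by auto

lemma orthonormal_fam_lin_indep:
  assumes "orthonormal_fam N k q"
  shows "lin_indep N {..<k} q"
  unfolding lin_indep_def
proof (intro allI impI ballI)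
  fix c i assume *: "\<forall>p<N. (\<Sum>i<k. c i * q i p) = 0" and i: "i \<in> {..<k}"
  have "0 = hinner N (\<lambda>p. \<Sum>i<k. c i * q i p) (q i)" using * by (simp add: hinner_def)
  also have "\<dots> = (\<Sum>j<k. c j * (if j = i then 1 else 0))"
    unfolding hinner_sum_left using assms i by (auto simp: orthonormal_fam_def intro!: sum.cong)
  also have "\<dots> = c i" using i by (subst sum.remove[of _ i]) auto
  finally show "c i = 0" by simp
qed

section \<open>Zero blocks and isotropic families\<close>

lemma lin_indep_card_le:
  assumes "finite I" "lin_indep N I w"
  shows "card I \<le> N"
proof (rule ccontr)
  assume "\<not> card I \<le> N"
  then have "card {..<N} < card I" by simp
  from homogeneous_system[OF _ assms(1) this, of "\<lambda>p i. w i p"] obtain c where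
    "\<exists>i\<in>I. c i \<noteq> 0" "\<forall>p\<in>{..<N}. (\<Sum>i\<in>I. w i p * c i) = 0" by auto
  then show False using assms(2) unfolding lin_indep_def by (auto simp: mult.commute)
qed

section \<open>Unitary matrices, sesquilinear forms and the passage between zero blocks and
  isotropic subspaces\<close>

lemma mat_adjoint_carrier: "A \<in> carrier_mat n m \<Longrightarrow> mat_adjoint A \<in> carrier_mat m n"
  by (auto simp: mat_adjoint_def)

lemma mat_adjoint_index:
  assumes "A \<in> carrier_mat n m" "i < m" "j < n"
  shows "mat_adjoint (A :: complex mat) $$ (i, j) = cnj (A $$ (j, i))"
proof -
  have "mat_adjoint A $$ (i, j) = conjugate (col A i) $ j"
    using assms by (auto simp: mat_adjoint_def mat_of_rows_def)
  then show ?thesis using assms by auto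
qed

lemma mat_mult_index:
  assumes "A \<in> carrier_mat n k" "B \<in> carrier_mat k m" "i < n" "j < m"
  shows "(A * B) $$ (i, j) = (\<Sum>l<k. A $$ (i, l) * B $$ (l, j))"
  using assms by (auto simp: scalar_prod_def atLeast0LessThan intro!: sum.cong)

lemma sandwich_assoc:
  assumes "P \<in> carrier_mat n n" "Q \<in> carrier_mat n n" "X \<in> carrier_mat n n"
    "R \<in> carrier_mat n n" "S \<in> carrier_mat n n"
  shows "P * (Q * X * R) * S = (P * Q) * X * (R * S)"
  using assms by (simp add: assoc_mult_mat[of _ n n _ n _ n] mult_carrier_mat[of _ n n _ n])

definition fam_mat :: "nat \<Rightarrow> (nat \<Rightarrow> nat \<Rightarrow> complex) \<Rightarrow> complex mat" where
  "fam_mat N q = mat N N (\<lambda>(p, a). q a p)"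

lemma fam_mat_carrier [simp]: "fam_mat N q \<in> carrier_mat N N"
  by (simp add: fam_mat_def)

lemma fam_mat_index: "p < N \<Longrightarrow> a < N \<Longrightarrow> fam_mat N q $$ (p, a) = q a p"
  by (simp add: fam_mat_def)

lemma fam_mat_unitary:
  assumes "orthonormal_fam N N q"
  shows "mat_adjoint (fam_mat N q) * fam_mat N q = 1\<^sub>m N" "fam_mat N q * mat_adjoint (fam_mat N q) = 1\<^sub>m N"
proof -
  let ?U = "fam_mat N q"
  have U: "?U \<in> carrier_mat N N" "mat_adjoint ?U \<in> carrier_mat N N"
    by (auto intro: mat_adjoint_carrier)
  show *: "mat_adjoint ?U * ?U = 1\<^sub>m N"
  proof (rule eq_matI)
    fix a b assume ab: "a < dim_row (1\<^sub>m N)" "b < dim_col (1\<^sub>m N)"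
    then have "(mat_adjoint ?U * ?U) $$ (a, b) = (\<Sum>l<N. mat_adjoint ?U $$ (a, l) * ?U $$ (l, b))"
      by (intro mat_mult_index[OF U(2,1)]) auto
    also have "\<dots> = hinner N (q b) (q a)"
      unfolding hinner_def using ab
      by (intro sum.cong) (auto simp: mat_adjoint_index[OF U(1)] fam_mat_index mult.commute)
    finally show "(mat_adjoint ?U * ?U) $$ (a, b) = 1\<^sub>m N $$ (a, b)"
      using assms ab by (auto simp: orthonormal_fam_def)
  qed (use U in \<open>simp_all add: carrier_matD[OF U(1)] carrier_matD[OF U(2)]\<close>)
  show "?U * mat_adjoint ?U = 1\<^sub>m N"
    by (rule mat_mult_left_right_inverse[OF U(2) U(1) *])
qed

text \<open>Linear in \<open>x\<close>, conjugate linear in \<open>y\<close>. Entry (a, b) of a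
  unitary conjugate is therefore the form at columns b and a, in this order.\<close>

definition sform :: "nat \<Rightarrow> complex mat \<Rightarrow> (nat \<Rightarrow> complex) \<Rightarrow> (nat \<Rightarrow> complex) \<Rightarrow> complex" where
  "sform N X x y = (\<Sum>p<N. \<Sum>q<N. cnj (y p) * X $$ (p, q) * x q)"

lemma sform_sum_left:
  "sform N X (\<lambda>p. \<Sum>i\<in>I. c i * w i p) y = (\<Sum>i\<in>I. c i * sform N X (w i) y)"
proof -
  have "sform N X (\<lambda>p. \<Sum>i\<in>I. c i * w i p) y
      = (\<Sum>p<N. \<Sum>q<N. \<Sum>i\<in>I. c i * (cnj (y p) * X $$ (p, q) * w i q))"
    by (simp add: sform_def sum_distrib_left mult_ac)
  also have "\<dots> = (\<Sum>p<N. \<Sum>i\<in>I. \<Sum>q<N. c i * (cnj (y p) * X $$ (p, q) * w i q))"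
    by (subst sum.swap) simp
  also have "\<dots> = (\<Sum>i\<in>I. \<Sum>p<N. \<Sum>q<N. c i * (cnj (y p) * X $$ (p, q) * w i q))"
    by (rule sum.swap)
  finally show ?thesis by (simp add: sform_def sum_distrib_left)
qed

lemma sform_sum_right:
  "sform N X x (\<lambda>p. \<Sum>i\<in>I. c i * w i p) = (\<Sum>i\<in>I. cnj (c i) * sform N X x (w i))"
proof -
  have "sform N X x (\<lambda>p. \<Sum>i\<in>I. c i * w i p)
      = (\<Sum>p<N. \<Sum>q<N. \<Sum>i\<in>I. cnj (c i) * (cnj (w i p) * X $$ (p, q) * x q))"
    by (simp add: sform_def sum_distrib_left sum_distrib_right mult_ac)
  also have "\<dots> = (\<Sum>p<N. \<Sum>i\<in>I. \<Sum>q<N. cnj (c i) * (cnj (w i p) * X $$ (p, q) * x q))"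
    by (subst sum.swap) simp
  also have "\<dots> = (\<Sum>i\<in>I. \<Sum>p<N. \<Sum>q<N. cnj (c i) * (cnj (w i p) * X $$ (p, q) * x q))"
    by (rule sum.swap)
  finally show ?thesis by (simp add: sform_def sum_distrib_left)
qed

lemma adjoint_mult_mult_index:
  assumes X: "X \<in> carrier_mat N N" and U: "U \<in> carrier_mat N N" and ab: "a < N" "b < N"
  shows "(mat_adjoint U * X * U) $$ (a, b) = sform N X (\<lambda>p. U $$ (p, b)) (\<lambda>p. U $$ (p, a))"
proof -
  have U': "mat_adjoint U \<in> carrier_mat N N" by (rule mat_adjoint_carrier[OF U])
  have "(mat_adjoint U * X * U) $$ (a, b) = (\<Sum>q<N. (mat_adjoint U * X) $$ (a, q) * U $$ (q, b))"
    by (rule mat_mult_index[OF mult_carrier_mat[OF U' X] U ab])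
  also have "\<dots> = (\<Sum>q<N. \<Sum>p<N. cnj (U $$ (p, a)) * X $$ (p, q) * U $$ (q, b))"
    using ab by (auto simp: mat_mult_index[OF U' X] mat_adjoint_index[OF U] sum_distrib_right
        intro!: sum.cong)
  also have "\<dots> = sform N X (\<lambda>p. U $$ (p, b)) (\<lambda>p. U $$ (p, a))"
    unfolding sform_def by (rule sum.swap)
  finally show ?thesis .
qed

lemma unitarily_similar_zero_block_imp_isotropic:
  assumes X: "X \<in> carrier_mat N N" and k: "k \<le> N"
    and B: "B \<in> carrier_mat k (N - k)" "C \<in> carrier_mat (N - k) k" "D \<in> carrier_mat (N - k) (N - k)"
    and sim: "unitarily_similar X (four_block_mat (0\<^sub>m k k) B C D)"
  obtains w where "lin_indep N {..<k} w"
    "\<And>a b. a < k \<Longrightarrow> b < k \<Longrightarrow> sform N X (w a) (w b) = 0"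
proof -
  define Y where "Y = four_block_mat (0\<^sub>m k k) B C D"
  obtain U where "similar_mat_wit X Y U (mat_adjoint U)"
    using sim unfolding unitarily_similar_def Y_def by blast
  then have U: "U \<in> carrier_mat N N" and Y: "Y \<in> carrier_mat N N"
    and UU: "mat_adjoint U * U = 1\<^sub>m N" and XY: "X = U * Y * mat_adjoint U"
    using X by (auto simp: similar_mat_wit_def Let_def)
  have U': "mat_adjoint U \<in> carrier_mat N N" by (rule mat_adjoint_carrier[OF U])
  have "mat_adjoint U * X * U = (mat_adjoint U * U) * Y * (mat_adjoint U * U)"
    unfolding XY by (rule sandwich_assoc[OF U' U Y U' U])
  then have Y_eq: "Y = mat_adjoint U * X * U" using Y by (simp add: UU)
  define q where "q a p = U $$ (p, a)" for a p
  have "orthonormal_fam N k q" unfolding orthonormal_fam_def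
  proof (intro allI impI)
    fix a b assume ab: "a < k" "b < k"
    have "hinner N (q a) (q b) = (\<Sum>l<N. mat_adjoint U $$ (b, l) * U $$ (l, a))"
      unfolding hinner_def q_def using ab k
      by (intro sum.cong) (auto simp: mat_adjoint_index[OF U] mult.commute)
    also have "\<dots> = (mat_adjoint U * U) $$ (b, a)"
      using ab k by (intro mat_mult_index[OF U' U, symmetric]) auto
    finally show "hinner N (q a) (q b) = (if a = b then 1 else 0)"
      unfolding UU using ab k by auto
  qed
  moreover have "sform N X (q a) (q b) = 0" if "a < k" "b < k" for a b
  proof -
    have "sform N X (q a) (q b) = Y $$ (b, a)"
      using adjoint_mult_mult_index[OF X U, of b a] that k by (simp add: Y_eq q_def[abs_def])
    also have "\<dots> = 0" unfolding Y_def using that B k by (subst index_mat_four_block) auto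
    finally show ?thesis .
  qed
  ultimately show thesis using orthonormal_fam_lin_indep that by blast
qed

text \<open>Orthonormalising within the span of \<open>w\<close> keeps the family isotropic by
  sesquilinearity. Completed to a basis, it supplies the columns of the unitary.\<close>

lemma isotropic_imp_unitarily_similar_zero_block:
  assumes X: "X \<in> carrier_mat N N" and I: "finite I" "lin_indep N I w"
    and iso: "\<And>i j. i \<in> I \<Longrightarrow> j \<in> I \<Longrightarrow> sform N X (w i) (w j) = 0"
    and k: "k = card I"
  shows "\<exists>B C D. B \<in> carrier_mat k (N - k) \<and> C \<in> carrier_mat (N - k) k \<and>
    D \<in> carrier_mat (N - k) (N - k) \<and> unitarily_similar X (four_block_mat (0\<^sub>m k k) B C D)"
proof -
  have kN: "k \<le> N" using lin_indep_card_le[OF I] k by simp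
  have "orthonormal_fam N 0 (\<lambda>_ _. 0)" by (simp add: orthonormal_fam_def)
  from orthonormal_fam_extend[OF this I, of k] k obtain q0 where q0: "orthonormal_fam N k q0"
    "\<And>a. a < k \<Longrightarrow> \<exists>c. q0 a = (\<lambda>p. \<Sum>i\<in>I. c i * w i p)" by auto
  obtain q where q: "orthonormal_fam N N q" "\<And>a. a < k \<Longrightarrow> q a = q0 a"
    using orthonormal_fam_complete[OF q0(1) kN] by blast
  have iso_q: "sform N X (q a) (q b) = 0" if "a < k" "b < k" for a b
  proof -
    obtain c d where "q a = (\<lambda>p. \<Sum>i\<in>I. c i * w i p)" "q b = (\<lambda>p. \<Sum>i\<in>I. d i * w i p)"
      using q0(2) q(2) \<open>a < k\<close> \<open>b < k\<close> by metis
    then show ?thesis by (simp add: sform_sum_left sform_sum_right iso)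
  qed
  let ?U = "fam_mat N q"
  have U: "?U \<in> carrier_mat N N" by simp
  have U': "mat_adjoint ?U \<in> carrier_mat N N" by (rule mat_adjoint_carrier[OF U])
  define Y where "Y = mat_adjoint ?U * X * ?U"
  have Y: "Y \<in> carrier_mat N N" unfolding Y_def using U' X U by (intro mult_carrier_mat)
  note UU = fam_mat_unitary[OF q(1)]
  have "?U * Y * mat_adjoint ?U = (?U * mat_adjoint ?U) * X * (?U * mat_adjoint ?U)"
    unfolding Y_def by (rule sandwich_assoc[OF U U' X U U'])
  then have "X = ?U * Y * mat_adjoint ?U" unfolding UU using X by simp
  from similar_mat_witI[OF UU(2,1) this X Y U U']
  have sim: "unitarily_similar X Y" unfolding unitarily_similar_def by blast
  have Y0: "Y $$ (a, b) = 0" if "a < k" "b < k" for a b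
  proof -
    have "Y $$ (a, b) = sform N X (\<lambda>p. ?U $$ (p, b)) (\<lambda>p. ?U $$ (p, a))"
      unfolding Y_def using that kN by (intro adjoint_mult_mult_index[OF X U]) auto
    also have "\<dots> = sform N X (q b) (q a)"
      unfolding sform_def using that kN by (auto simp: fam_mat_index intro!: sum.cong)
    finally show ?thesis using iso_q that by simp
  qed
  define B where "B = mat k (N - k) (\<lambda>(i, j). Y $$ (i, j + k))"
  define C where "C = mat (N - k) k (\<lambda>(i, j). Y $$ (i + k, j))"
  define D where "D = mat (N - k) (N - k) (\<lambda>(i, j). Y $$ (i + k, j + k))"
  have "Y = four_block_mat (0\<^sub>m k k) B C D"
    using Y kN Y0 by (intro eq_matI) (auto simp: B_def C_def D_def)
  then show ?thesis using sim
    by (intro exI[of _ B] exI[of _ C] exI[of _ D]) (auto simp: B_def C_def D_def)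
qed

text \<open>Reduces the index to linearly independent isotropic families, so that neither bound
  below has to deal with block matrices.\<close>

lemma zero_dilation_index_eqI:
  assumes X: "X \<in> carrier_mat N N" and I: "finite I" "lin_indep N I w"
    and iso: "\<And>i j. i \<in> I \<Longrightarrow> j \<in> I \<Longrightarrow> sform N X (w i) (w j) = 0"
    and upper: "\<And>k w. lin_indep N {..<k} w \<Longrightarrow>
      (\<And>a b. a < k \<Longrightarrow> b < k \<Longrightarrow> sform N X (w a) (w b) = 0) \<Longrightarrow> k \<le> card I"
  shows "zero_dilation_index X = card I"
proof -
  have N: "dim_row X = N" using X by simp
  show ?thesis unfolding zero_dilation_index_def N
  proof (rule Greatest_equality, intro conjI)
    show "card I \<le> N" by (rule lin_indep_card_le[OF I])
    show "\<exists>B C D. B \<in> carrier_mat (card I) (N - card I) \<and> C \<in> carrier_mat (N - card I) (card I) \<and>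
      D \<in> carrier_mat (N - card I) (N - card I) \<and>
      unitarily_similar X (four_block_mat (0\<^sub>m (card I) (card I)) B C D)"
      by (rule isotropic_imp_unitarily_similar_zero_block[OF X I iso refl])
  next
    fix k assume k: "k \<le> N \<and> (\<exists>B C D. B \<in> carrier_mat k (N - k) \<and> C \<in> carrier_mat (N - k) k \<and>
      D \<in> carrier_mat (N - k) (N - k) \<and> unitarily_similar X (four_block_mat (0\<^sub>m k k) B C D))"
    then obtain B C D where *: "k \<le> N" "B \<in> carrier_mat k (N - k)" "C \<in> carrier_mat (N - k) k"
      "D \<in> carrier_mat (N - k) (N - k)" "unitarily_similar X (four_block_mat (0\<^sub>m k k) B C D)"
      by blast
    show "k \<le> card I"
      by (rule unitarily_similar_zero_block_imp_isotropic[OF X *]) (rule upper)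
  qed
qed

section \<open>Diagonalisation of normal matrices\<close>

definition mat_apply :: "nat \<Rightarrow> complex mat \<Rightarrow> (nat \<Rightarrow> complex) \<Rightarrow> nat \<Rightarrow> complex" where
  "mat_apply n A x p = (\<Sum>q<n. A $$ (p, q) * x q)"

lemma hinner_mat_apply_left: "hinner n (mat_apply n A x) y = sform n A x y"
  by (simp add: hinner_def mat_apply_def sform_def sum_distrib_left sum_distrib_right mult_ac)

lemma hinner_mat_apply_right: "hinner n x (mat_apply n A y) = cnj (sform n A y x)"
  by (metis hinner_cnj hinner_mat_apply_left)

lemma sform_adjoint:
  assumes "A \<in> carrier_mat n n"
  shows "sform n (mat_adjoint A) x y = cnj (sform n A y x)"
proof -
  have "sform n (mat_adjoint A) x y = (\<Sum>p<n. \<Sum>q<n. cnj (y p) * cnj (A $$ (q, p)) * x q)"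
    unfolding sform_def by (intro sum.cong) (auto simp: mat_adjoint_index[OF assms])
  also have "\<dots> = (\<Sum>q<n. \<Sum>p<n. cnj (y p) * cnj (A $$ (q, p)) * x q)" by (rule sum.swap)
  finally show ?thesis by (simp add: sform_def mult_ac)
qed

lemma mat_apply_mult:
  assumes "A \<in> carrier_mat n n" "B \<in> carrier_mat n n" "p < n"
  shows "mat_apply n (A * B) x p = mat_apply n A (mat_apply n B x) p"
proof -
  have "mat_apply n (A * B) x p = (\<Sum>q<n. \<Sum>l<n. A $$ (p, l) * B $$ (l, q) * x q)"
    unfolding mat_apply_def
    by (intro sum.cong) (auto simp: mat_mult_index[OF assms(1,2)] assms(3) sum_distrib_right
        simp del: index_mult_mat)
  also have "\<dots> = (\<Sum>l<n. \<Sum>q<n. A $$ (p, l) * B $$ (l, q) * x q)" by (rule sum.swap)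
  finally show ?thesis by (simp add: mat_apply_def sum_distrib_left mult.assoc)
qed

lemma hinner_cong:
  "(\<And>p. p < n \<Longrightarrow> x p = x' p) \<Longrightarrow> (\<And>p. p < n \<Longrightarrow> y p = y' p) \<Longrightarrow> hinner n x y = hinner n x' y'"
  by (auto simp: hinner_def intro!: sum.cong)

lemma hinner_self_mat_apply:
  assumes A: "A \<in> carrier_mat n n"
  shows "hinner n (mat_apply n A x) (mat_apply n A x) = hinner n (mat_apply n (mat_adjoint A * A) x) x"
proof -
  have A': "mat_adjoint A \<in> carrier_mat n n" by (rule mat_adjoint_carrier[OF A])
  have "hinner n (mat_apply n (mat_adjoint A * A) x) x = hinner n (mat_apply n (mat_adjoint A) (mat_apply n A x)) x"
    by (rule hinner_cong) (simp_all add: mat_apply_mult[OF A' A])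
  also have "\<dots> = cnj (sform n A x (mat_apply n A x))"
    by (simp add: hinner_mat_apply_left sform_adjoint[OF A])
  also have "\<dots> = hinner n (mat_apply n A x) (mat_apply n A x)" by (simp add: hinner_mat_apply_right)
  finally show ?thesis by simp
qed

lemma mat_adjoint_adjoint:
  fixes A :: "complex mat"
  assumes A: "A \<in> carrier_mat n n"
  shows "mat_adjoint (mat_adjoint A) = A"
proof (rule eq_matI)
  note A' = mat_adjoint_carrier[OF A]
  fix i j assume "i < dim_row A" "j < dim_col A"
  then show "mat_adjoint (mat_adjoint A) $$ (i, j) = A $$ (i, j)"
    using A by (simp add: mat_adjoint_index[OF A'] mat_adjoint_index[OF A])
qed (use mat_adjoint_carrier[OF mat_adjoint_carrier[OF A]] A in auto)

lemma hinner_self_eq_0: "hinner n x x = 0 \<Longrightarrow> p < n \<Longrightarrow> x p = 0"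
  unfolding hinner_self of_real_eq_0_iff by (simp add: sum_nonneg_eq_0_iff)

lemma hinner_diff_diff:
  "hinner n (\<lambda>p. x p - c * y p) (\<lambda>p. x p - c * y p)
    = hinner n x x - cnj c * hinner n x y - c * hinner n y x + c * cnj c * hinner n y y"
  by (simp add: hinner_def sum_distrib_left sum_subtractf sum.distrib algebra_simps)

text \<open>A normal \<open>A\<close> satisfies \<open>\<parallel>(A - d) v\<parallel> = \<parallel>(A - d)\<^sup>* v\<parallel>\<close>.\<close>

lemma normal_mat_adjoint_eigenvector:
  assumes A: "A \<in> carrier_mat n n" and normal: "normal_mat A"
    and v: "\<And>p. p < n \<Longrightarrow> mat_apply n A v p = d * v p" and "p < n"
  shows "mat_apply n (mat_adjoint A) v p = cnj d * v p"
proof -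
  let ?B = "mat_adjoint A"
  have B: "?B \<in> carrier_mat n n" by (rule mat_adjoint_carrier[OF A])
  have 1: "sform n A v v = d * hinner n v v"
  proof -
    have "sform n A v v = hinner n (\<lambda>p. d * v p) v"
      unfolding hinner_mat_apply_left[symmetric] by (rule hinner_cong) (simp_all add: v)
    then show ?thesis by (simp add: hinner_def sum_distrib_left mult.assoc)
  qed
  have real: "cnj (hinner n v v) = hinner n v v" by (rule hinner_cnj)
  have "hinner n (mat_apply n ?B v) (mat_apply n ?B v) = hinner n (mat_apply n (A * ?B) v) v"
    using hinner_self_mat_apply[OF B] by (simp add: mat_adjoint_adjoint[OF A])
  also have "\<dots> = hinner n (mat_apply n A v) (mat_apply n A v)"
    using hinner_self_mat_apply[OF A] normal by (simp add: normal_mat_def)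
  also have "\<dots> = hinner n (\<lambda>p. d * v p) (\<lambda>p. d * v p)"
    by (rule hinner_cong) (simp_all add: v)
  also have "\<dots> = d * cnj d * hinner n v v" by (simp add: hinner_def sum_distrib_left mult_ac)
  finally have 2: "hinner n (mat_apply n ?B v) (mat_apply n ?B v) = d * cnj d * hinner n v v" .
  have 3: "hinner n (mat_apply n ?B v) v = cnj d * hinner n v v"
    by (simp add: hinner_mat_apply_left sform_adjoint[OF A] 1 real)
  have 4: "hinner n v (mat_apply n ?B v) = d * hinner n v v"
    by (simp add: hinner_mat_apply_right sform_adjoint[OF A] 1)
  have "hinner n (\<lambda>p. mat_apply n ?B v p - cnj d * v p) (\<lambda>p. mat_apply n ?B v p - cnj d * v p) = 0"
    unfolding hinner_diff_diff 2 3 4 by (simp add: algebra_simps)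
  from hinner_self_eq_0[OF this \<open>p < n\<close>] show ?thesis by simp
qed

lemma orthonormal_fam_resolution:
  assumes q: "orthonormal_fam n n q" and "p < n" "p' < n"
  shows "(\<Sum>a<n. q a p * cnj (q a p')) = (if p = p' then 1 else 0)"
proof -
  let ?U = "fam_mat n q"
  have U: "?U \<in> carrier_mat n n" "mat_adjoint ?U \<in> carrier_mat n n"
    by (auto intro: mat_adjoint_carrier)
  have "(\<Sum>a<n. q a p * cnj (q a p')) = (\<Sum>a<n. ?U $$ (p, a) * mat_adjoint ?U $$ (a, p'))"
    using assms by (intro sum.cong) (auto simp: mat_adjoint_index[OF U(1)] fam_mat_index)
  also have "\<dots> = (?U * mat_adjoint ?U) $$ (p, p')"
    by (rule mat_mult_index[OF U assms(2,3), symmetric])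
  finally show ?thesis using assms by (simp add: fam_mat_unitary(2)[OF q])
qed

lemma orthonormal_fam_expand:
  assumes q: "orthonormal_fam n n q" and "p < n"
  shows "x p = (\<Sum>a<n. hinner n x (q a) * q a p)"
proof -
  have "(\<Sum>a<n. hinner n x (q a) * q a p) = (\<Sum>a<n. \<Sum>p'<n. x p' * (q a p * cnj (q a p')))"
    by (simp add: hinner_def sum_distrib_left sum_distrib_right mult_ac)
  also have "\<dots> = (\<Sum>p'<n. x p' * (\<Sum>a<n. q a p * cnj (q a p')))"
    by (subst sum.swap) (simp add: sum_distrib_left)
  also have "\<dots> = (\<Sum>p'<n. x p' * (if p = p' then 1 else 0))"
    using \<open>p < n\<close> by (intro sum.cong) (auto simp: orthonormal_fam_resolution[OF q])
  also have "\<dots> = x p" using \<open>p < n\<close> by (subst sum.remove[of _ p]) auto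
  finally show ?thesis by simp
qed

lemma eigenvector_exists:
  fixes C :: "complex mat"
  assumes C: "C \<in> carrier_mat k k" and "0 < k"
  obtains c l where "\<exists>i<k. c i \<noteq> 0" "\<And>i. i < k \<Longrightarrow> mat_apply k C c i = l * c i"
proof -
  from spectrum_non_empty[OF C \<open>0 < k\<close>] obtain l where "eigenvalue C l"
    unfolding spectrum_def by auto
  then obtain v where v: "v \<in> carrier_vec k" "v \<noteq> 0\<^sub>v k" "C *\<^sub>v v = l \<cdot>\<^sub>v v"
    using C by (auto simp: eigenvalue_def eigenvector_def)
  have "\<exists>i<k. v $ i \<noteq> 0" using v(1,2) by (auto simp: vec_eq_iff)
  moreover have "mat_apply k C (\<lambda>i. v $ i) i = l * v $ i" if "i < k" for i
  proof -
    have "mat_apply k C (\<lambda>i. v $ i) i = (C *\<^sub>v v) $ i"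
      using C v(1) that by (auto simp: mat_apply_def scalar_prod_def atLeast0LessThan intro!: sum.cong)
    then show ?thesis using v that by simp
  qed
  ultimately show thesis by (rule that)
qed

text \<open>The orthogonal complement of the eigenvectors found so far is invariant under
  \<open>A\<close>. Hence an eigenvector of \<open>C\<close>, the compression of \<open>A\<close> to
  this complement, is already an eigenvector of \<open>A\<close>.\<close>

lemma normal_mat_extend_eigenvectors:
  assumes A: "A \<in> carrier_mat n n" and normal: "normal_mat A" and "j < n"
    and q: "orthonormal_fam n j q"
    and d: "\<And>a p. a < j \<Longrightarrow> p < n \<Longrightarrow> mat_apply n A (q a) p = d a * q a p"
  obtains v l where "hinner n v v = 1" "\<And>a. a < j \<Longrightarrow> hinner n v (q a) = 0"
    "\<And>p. p < n \<Longrightarrow> mat_apply n A v p = l * v p"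
proof -
  obtain q' where q': "orthonormal_fam n n q'" "\<And>a. a < j \<Longrightarrow> q' a = q a"
    using orthonormal_fam_complete[OF q] \<open>j < n\<close> by (metis less_imp_le)
  define C where "C = mat (n - j) (n - j) (\<lambda>(a, b). sform n A (q' (b + j)) (q' (a + j)))"
  obtain c l where c: "\<exists>i<n-j. c i \<noteq> 0" "\<And>i. i < n - j \<Longrightarrow> mat_apply (n - j) C c i = l * c i"
    by (rule eigenvector_exists[of C "n - j"]) (use \<open>j < n\<close> in \<open>auto simp: C_def\<close>)
  define v where "v p = (\<Sum>b<n - j. c b * q' (b + j) p)" for p
  have orth: "hinner n v (q' a) = (if a < j then 0 else c (a - j))" if "a < n" for a
  proof -
    have "hinner n v (q' a) = (\<Sum>b<n - j. c b * (if b + j = a then 1 else 0))"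
      unfolding v_def[abs_def] hinner_sum_left using q'(1) that
      by (intro sum.cong) (auto simp: orthonormal_fam_def)
    also have "\<dots> = (if a < j then 0 else c (a - j))"
    proof (cases "a < j")
      case False
      then have "(\<Sum>b<n - j. c b * (if b + j = a then 1 else 0))
          = (\<Sum>b<n - j. if b = a - j then c b else 0)" by (intro sum.cong) auto
      then show ?thesis using False that by (simp add: sum.delta)
    qed auto
    finally show ?thesis .
  qed
  have Av: "hinner n (mat_apply n A v) (q' a) = l * hinner n v (q' a)" if "a < n" for a
  proof -
    have *: "hinner n (mat_apply n A v) (q' a) = (\<Sum>b<n - j. c b * sform n A (q' (b + j)) (q' a))"
      by (simp add: hinner_mat_apply_left v_def[abs_def] sform_sum_left)
    show ?thesis
    proof (cases "a < j")
      case True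
      \<comment> \<open>Normality enters here: the adjoint maps \<open>q' a\<close> to a multiple of
        itself, so \<open>A\<close> cannot lead from the complement back to
        \<open>q' a\<close>.\<close>
      have "sform n A x (q' a) = d a * hinner n x (q' a)" for x
      proof -
        have "sform n A x (q' a) = hinner n x (mat_apply n (mat_adjoint A) (q' a))"
          by (simp add: hinner_mat_apply_right sform_adjoint[OF A])
        also have "\<dots> = hinner n x (\<lambda>p. cnj (d a) * q' a p)"
          using normal_mat_adjoint_eigenvector[OF A normal d[OF True]] q'(2)[OF True]
          by (intro hinner_cong) auto
        finally show ?thesis by (simp add: hinner_def sum_distrib_left mult_ac)
      qed
      moreover have "hinner n (q' (b + j)) (q' a) = 0" if "b < n - j" for b
        using q'(1) that True \<open>a < n\<close> by (auto simp: orthonormal_fam_def)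
      ultimately show ?thesis unfolding * orth[OF that] using True by simp
    next
      case False
      then have "(\<Sum>b<n - j. c b * sform n A (q' (b + j)) (q' a)) = mat_apply (n - j) C c (a - j)"
        using that by (auto simp: mat_apply_def C_def mult.commute intro!: sum.cong)
      also have "\<dots> = l * c (a - j)" using c(2) that False by simp
      finally show ?thesis unfolding * orth[OF that] using False by simp
    qed
  qed
  have eig: "mat_apply n A v p = l * v p" if "p < n" for p
  proof -
    have "mat_apply n A v p = (\<Sum>a<n. hinner n (mat_apply n A v) (q' a) * q' a p)"
      by (rule orthonormal_fam_expand[OF q'(1) that])
    also have "\<dots> = l * (\<Sum>a<n. hinner n v (q' a) * q' a p)"
      by (simp add: Av sum_distrib_left mult.assoc)
    also have "(\<Sum>a<n. hinner n v (q' a) * q' a p) = v p"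
      by (rule orthonormal_fam_expand[OF q'(1) that, symmetric])
    finally show ?thesis .
  qed
  \<comment> \<open>Independence of a one-element family says that \<open>v\<close> is nonzero;
    \<open>unit_vector_orthogonal\<close> with no constraints then normalises it.\<close>
  have "lin_indep n {()} (\<lambda>_. v)" unfolding lin_indep_def
  proof (intro allI impI ballI)
    fix t :: "unit \<Rightarrow> complex" and i
    assume *: "\<forall>p<n. (\<Sum>i\<in>{()}. t i * v p) = 0"
    obtain i0 where i0: "i0 < n - j" "c i0 \<noteq> 0" using c(1) by blast
    have "0 = hinner n (\<lambda>p. t () * v p) (q' (i0 + j))" unfolding hinner_def
      by (rule sum.neutral[symmetric]) (use * in auto)
    also have "\<dots> = t () * hinner n v (q' (i0 + j))" by (simp add: hinner_def sum_distrib_left mult.assoc)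
    also have "\<dots> = t () * c i0" using orth[of "i0 + j"] i0(1) by simp
    finally show "t i = 0" using i0(2) by (cases i) simp
  qed
  from unit_vector_orthogonal[OF _ this, of 0] obtain t where
    t: "hinner n (\<lambda>p. t () * v p) (\<lambda>p. t () * v p) = 1" by auto
  show thesis
  proof (rule that[of "\<lambda>p. t () * v p" l])
    show "hinner n (\<lambda>p. t () * v p) (q a) = 0" if "a < j" for a
    proof -
      have "hinner n (\<lambda>p. t () * v p) (q a) = t () * hinner n v (q' a)"
        using q'(2)[OF that] by (simp add: hinner_def sum_distrib_left mult.assoc)
      then show ?thesis using orth[of a] that \<open>j < n\<close> by simp
    qed
    show "mat_apply n A (\<lambda>p. t () * v p) p = l * (t () * v p)" if "p < n" for p
    proof -
      have "mat_apply n A (\<lambda>p. t () * v p) p = t () * mat_apply n A v p"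
        by (simp add: mat_apply_def sum_distrib_left mult_ac)
      then show ?thesis using eig[OF that] by simp
    qed
  qed (fact t)
qed

lemma normal_mat_eigenbasis:
  assumes A: "A \<in> carrier_mat n n" and normal: "normal_mat A"
  obtains q d where "orthonormal_fam n n q"
    "\<And>a p. a < n \<Longrightarrow> p < n \<Longrightarrow> mat_apply n A (q a) p = d a * q a p"
proof -
  have "\<exists>q d. orthonormal_fam n j q \<and> (\<forall>a<j. \<forall>p<n. mat_apply n A (q a) p = d a * q a p)"
    if "j \<le> n" for j
    using that
  proof (induction j)
    case 0
    then show ?case by (simp add: orthonormal_fam_def)
  next
    case (Suc j)
    then obtain q d where q: "orthonormal_fam n j q"
      "\<forall>a<j. \<forall>p<n. mat_apply n A (q a) p = d a * q a p" by auto
    obtain v l where v: "hinner n v v = 1" "\<And>a. a < j \<Longrightarrow> hinner n v (q a) = 0"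
      "\<And>p. p < n \<Longrightarrow> mat_apply n A v p = l * v p"
      using normal_mat_extend_eigenvectors[OF A normal _ q(1), of d] q(2) Suc.prems
      by (metis Suc_le_eq)
    have "hinner n (q a) v = 0" if "a < j" for a
      using arg_cong[OF v(2)[OF that], of cnj] by (simp add: hinner_cnj)
    then have "orthonormal_fam n (Suc j) (q(j := v))"
      using q(1) v unfolding orthonormal_fam_def by (auto simp: less_Suc_eq)
    moreover have "\<forall>a<Suc j. \<forall>p<n. mat_apply n A ((q(j := v)) a) p = (d(j := l)) a * (q(j := v)) a p"
      using q(2) v(3) by (auto simp: less_Suc_eq)
    ultimately show ?case by blast
  qed
  from this[of n] show thesis using that by blast
qed

text \<open>Spectral decomposition of the power: apply it to the resolution of the identity
  \<open>orthonormal_fam_resolution\<close>, where each \<open>q a\<close> is multiplied by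
  \<open>d a ^ k\<close>.\<close>

lemma eigenbasis_pow_index:
  assumes A: "A \<in> carrier_mat n n" and q: "orthonormal_fam n n q"
    and d: "\<And>a p. a < n \<Longrightarrow> p < n \<Longrightarrow> mat_apply n A (q a) p = d a * q a p"
    and "p < n" "p' < n"
  shows "(A ^\<^sub>m k) $$ (p, p') = (\<Sum>a<n. q a p * d a ^ k * cnj (q a p'))"
proof -
  have pow: "mat_apply n (A ^\<^sub>m k) (q a) p = d a ^ k * q a p" if "a < n" "p < n" for a p
    using that(2)
  proof (induction k arbitrary: p)
    case 0
    have "mat_apply n (1\<^sub>m n) (q a) p = (\<Sum>r<n. if r = p then q a r else 0)"
      unfolding mat_apply_def using 0 by (intro sum.cong) auto
    then show ?case using 0 A by (simp add: sum.delta)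
  next
    case (Suc k)
    have "mat_apply n (A ^\<^sub>m Suc k) (q a) p = mat_apply n (A ^\<^sub>m k) (mat_apply n A (q a)) p"
      using A Suc.prems by (simp add: mat_apply_mult[of _ n] pow_carrier_mat)
    also have "\<dots> = mat_apply n (A ^\<^sub>m k) (\<lambda>p. d a * q a p) p"
      unfolding mat_apply_def[of n "A ^\<^sub>m k"] by (intro sum.cong) (simp_all add: d \<open>a < n\<close>)
    also have "\<dots> = d a * mat_apply n (A ^\<^sub>m k) (q a) p"
      by (simp add: mat_apply_def sum_distrib_left mult_ac)
    finally show ?case using Suc by simp
  qed
  have "(A ^\<^sub>m k) $$ (p, p') = (\<Sum>c<n. (A ^\<^sub>m k) $$ (p, c) * (if c = p' then 1 else 0))"
    using \<open>p' < n\<close> by (subst sum.remove[of _ p']) auto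
  also have "\<dots> = (\<Sum>c<n. (A ^\<^sub>m k) $$ (p, c) * (\<Sum>a<n. q a c * cnj (q a p')))"
    using \<open>p' < n\<close> by (intro sum.cong) (auto simp: orthonormal_fam_resolution[OF q])
  also have "\<dots> = (\<Sum>a<n. mat_apply n (A ^\<^sub>m k) (q a) p * cnj (q a p'))"
    unfolding mat_apply_def sum_distrib_left sum_distrib_right
    by (subst sum.swap) (simp add: mult.assoc)
  also have "\<dots> = (\<Sum>a<n. q a p * d a ^ k * cnj (q a p'))"
    using \<open>p < n\<close> by (intro sum.cong) (auto simp: pow mult.commute)
  finally show ?thesis .
qed

text \<open>Links the eigenvalues \<open>d\<close> of the constructed basis to the list prescribed
  in the theorem, which is known only through the characteristic polynomial.\<close>

lemma eigenbasis_char_poly: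
  assumes A: "A \<in> carrier_mat n n" and q: "orthonormal_fam n n q"
    and d: "\<And>a p. a < n \<Longrightarrow> p < n \<Longrightarrow> mat_apply n A (q a) p = d a * q a p"
  shows "char_poly A = (\<Prod>a<n. [:- d a, 1:])"
proof -
  let ?U = "fam_mat n q" and ?D = "mat n n (\<lambda>(i, j). if i = j then d i else 0)"
  have U: "?U \<in> carrier_mat n n" "mat_adjoint ?U \<in> carrier_mat n n"
    by (auto intro: mat_adjoint_carrier)
  have D: "?D \<in> carrier_mat n n" by simp
  have "A * ?U = ?U * ?D"
  proof (rule eq_matI)
    fix p a assume "p < dim_row (?U * ?D)" "a < dim_col (?U * ?D)"
    then have pa: "p < n" "a < n" by (auto simp: fam_mat_def)
    have "(A * ?U) $$ (p, a) = (\<Sum>l<n. A $$ (p, l) * ?U $$ (l, a))"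
      by (rule mat_mult_index[OF A U(1) pa])
    also have "\<dots> = d a * q a p"
      unfolding d[OF pa(2,1), symmetric] mat_apply_def using pa by (simp add: fam_mat_index)
    also have "\<dots> = (\<Sum>l<n. if l = a then q l p * d l else 0)" using pa by (simp add: sum.delta)
    also have "\<dots> = (\<Sum>l<n. ?U $$ (p, l) * ?D $$ (l, a))"
      using pa by (intro sum.cong) (auto simp: fam_mat_index)
    also have "\<dots> = (?U * ?D) $$ (p, a)" by (rule mat_mult_index[OF U(1) D pa, symmetric])
    finally show "(A * ?U) $$ (p, a) = (?U * ?D) $$ (p, a)" .
  qed (use A U in \<open>simp_all add: carrier_matD[OF U(1)]\<close>)
  then have "?U * ?D * mat_adjoint ?U = A * (?U * mat_adjoint ?U)"
    using A U by (simp add: assoc_mult_mat[of _ n n _ n _ n, symmetric])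
  then have "A = ?U * ?D * mat_adjoint ?U" using A by (simp add: fam_mat_unitary(2)[OF q])
  from similar_mat_witI[OF fam_mat_unitary(2,1)[OF q] this A D U] have "similar_mat A ?D"
    unfolding similar_mat_def by blast
  then have "char_poly A = char_poly ?D" by (rule char_poly_similar)
  also have "\<dots> = (\<Prod>a\<leftarrow>diag_mat ?D. [:- a, 1:])"
    by (rule char_poly_upper_triangular[OF D]) auto
  also have "\<dots> = (\<Prod>a<n. [:- d a, 1:])"
  proof -
    have "diag_mat ?D = map d [0..<n]" by (auto simp: diag_mat_def)
    then show ?thesis
      using prod.distinct_set_conv_list[of "[0..<n]" "\<lambda>a. [:- d a, 1:]"]
      by (simp add: comp_def atLeast0LessThan)
  qed
  finally show ?thesis .
qed

section \<open>The spectrum of the path\<close>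

text \<open>The discrete sine transform: for fixed \<open>l\<close> an eigenvector of the path on 1,
  ..., n, extended by zero at 0 and n + 1. The matrix is symmetric in \<open>l\<close> and
  \<open>i\<close>.\<close>

definition dst :: "nat \<Rightarrow> nat \<Rightarrow> nat \<Rightarrow> real" where
  "dst n l i = sin (real i * (real l * pi / (real n + 1)))"

lemma dst_sym: "dst n l i = dst n i l"
  by (simp add: dst_def mult_ac)

lemma dst_0: "dst n l 0 = 0"
  by (simp add: dst_def)

lemma dst_Suc_n: "dst n l (Suc n) = 0"
proof -
  have "real (Suc n) * (real l * pi / (real n + 1)) = real l * pi" by (simp add: field_simps)
  then show ?thesis by (simp add: dst_def)
qed

lemma sin_recurrence:
  fixes t :: real
  shows "sin (real (Suc (Suc i)) * t) + sin (real i * t) = 2 * cos t * sin (real (Suc i) * t)"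
proof -
  have "real (Suc (Suc i)) * t = real (Suc i) * t + t" "real i * t = real (Suc i) * t - t"
    by (simp_all add: algebra_simps)
  then show ?thesis by (simp only: sin_add sin_diff) simp
qed

lemma dst_recurrence:
  "dst n l (Suc (Suc i)) + dst n l i = 2 * cos (real l * pi / (real n + 1)) * dst n l (Suc i)"
  unfolding dst_def by (rule sin_recurrence)

lemma dst_angle_bounds:
  assumes "l \<in> {1..n}"
  shows "0 < real l * pi / (real n + 1)" "real l * pi / (real n + 1) < pi"
proof -
  have "real l * pi < (real n + 1) * pi" using assms by (intro mult_strict_right_mono) auto
  then show "real l * pi / (real n + 1) < pi" by (simp add: pos_divide_less_eq mult.commute)
qed (use assms in auto)

lemma dst_orthogonal:
  assumes l: "l \<in> {1..n}" "l' \<in> {1..n}" "l \<noteq> l'"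
  shows "(\<Sum>i=1..n. dst n l i * dst n l' i) = 0"
proof -
  define c where "c l = cos (real l * pi / (real n + 1))" for l
  \<comment> \<open>Discrete Green identity: both sequences satisfy three-term recurrences with
    different constants, and the sum telescopes to a boundary term, which vanishes at
    \<open>N = n\<close>.\<close>
  have green: "2 * (c l - c l') * (\<Sum>i=1..N. dst n l i * dst n l' i)
      = dst n l (Suc N) * dst n l' N - dst n l N * dst n l' (Suc N)" for N
  proof (induction N)
    case 0
    then show ?case by (simp add: dst_0)
  next
    case (Suc N)
    have 1: "dst n l (Suc (Suc N)) = 2 * c l * dst n l (Suc N) - dst n l N"
      "dst n l' (Suc (Suc N)) = 2 * c l' * dst n l' (Suc N) - dst n l' N"
      using dst_recurrence[of n l N] dst_recurrence[of n l' N] by (auto simp: c_def)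
    have "2 * (c l - c l') * (\<Sum>i=1..Suc N. dst n l i * dst n l' i)
      = 2 * (c l - c l') * (\<Sum>i=1..N. dst n l i * dst n l' i)
        + 2 * (c l - c l') * (dst n l (Suc N) * dst n l' (Suc N))"
      by (simp add: distrib_left)
    then show ?case unfolding Suc 1 by (simp add: algebra_simps)
  qed
  have "c l \<noteq> c l'"
  proof
    assume "c l = c l'"
    then have "real l * pi / (real n + 1) = real l' * pi / (real n + 1)"
      unfolding c_def using dst_angle_bounds(1)[OF l(1), THEN less_imp_le]
        dst_angle_bounds(2)[OF l(1), THEN less_imp_le] dst_angle_bounds(1)[OF l(2), THEN less_imp_le]
        dst_angle_bounds(2)[OF l(2), THEN less_imp_le] by (metis cos_inj_pi)
    moreover have "real n + 1 \<noteq> 0" by linarith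
    ultimately show False using l(3) by simp
  qed
  then show ?thesis using green[of n] by (simp add: dst_Suc_n)
qed

lemma dst_norm:
  assumes l: "l \<in> {1..n}"
  shows "(\<Sum>i=1..n. dst n l i * dst n l i) = (real n + 1) / 2"
proof -
  define t where "t = real l * pi / (real n + 1)"
  have t: "0 < t" "t < pi" using dst_angle_bounds[OF l] by (auto simp: t_def)
  \<comment> \<open>Telescoping of 4 sin t sin^2 (i t) = 2 sin t - sin ((2 i + 1) t) + sin ((2 i -
    1) t).\<close>
  have *: "4 * sin t * (\<Sum>i=1..N. sin (real i * t) * sin (real i * t))
      = (2 * real N + 1) * sin t - sin ((2 * real N + 1) * t)" for N
  proof (induction N)
    case (Suc N)
    define x where "x = (2 * real N + 2) * t"
    have x: "(2 * real N + 1) * t = x - t" "(2 * real (Suc N) + 1) * t = x + t"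
      "real (Suc N) * t = x / 2" by (simp_all add: x_def algebra_simps)
    have cos_x: "cos x = 1 - 2 * (sin (x / 2))\<^sup>2" using cos_double_sin[of "x / 2"] by simp
    have "4 * sin t * (sin (x / 2) * sin (x / 2)) = 2 * sin t - 2 * sin t * cos x"
      unfolding cos_x by (simp add: power2_eq_square algebra_simps)
    moreover have "(\<Sum>i=1..Suc N. sin (real i * t) * sin (real i * t))
      = (\<Sum>i=1..N. sin (real i * t) * sin (real i * t)) + sin (x / 2) * sin (x / 2)"
      unfolding x(3)[symmetric] by (subst sum.nat_ivl_Suc') simp_all
    then have "4 * sin t * (\<Sum>i=1..Suc N. sin (real i * t) * sin (real i * t))
      = 4 * sin t * (\<Sum>i=1..N. sin (real i * t) * sin (real i * t))
        + 4 * sin t * (sin (x / 2) * sin (x / 2))"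
      by (simp only: distrib_left)
    ultimately show ?case unfolding Suc x sin_add sin_diff by (simp add: algebra_simps)
  qed simp
  have "(2 * real n + 1) * t = 2 * (real l * pi) - t"
    by (simp add: t_def field_simps)
  moreover have "sin (2 * (real l * pi) - t) = - sin t"
    unfolding sin_diff by (simp add: sin_double cos_double power2_eq_square power_mult_distrib[symmetric])
  ultimately have sin_eq: "sin ((2 * real n + 1) * t) = - sin t" by (simp only:)
  have "4 * sin t * (\<Sum>i=1..n. sin (real i * t) * sin (real i * t)) = (2 * real n + 2) * sin t"
    unfolding * sin_eq by (simp add: algebra_simps)
  then have "sin t * (4 * (\<Sum>i=1..n. sin (real i * t) * sin (real i * t))) = sin t * (2 * real n + 2)"
    by (simp only: mult.commute mult.left_commute)
  moreover have "sin t \<noteq> 0" using t sin_gt_zero[of t] by simp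
  ultimately have "4 * (\<Sum>i=1..n. sin (real i * t) * sin (real i * t)) = 2 * real n + 2"
    by (simp only: mult_cancel_left) simp
  then show ?thesis unfolding dst_def t_def[symmetric] by simp
qed

text \<open>The sine matrix is symmetric with orthogonal rows of equal norm, hence a multiple of a
  unitary matrix. The symmetry turns the sum over \<open>l\<close> into an inner product of two
  eigenvectors.\<close>

lemma dst_parseval:
  fixes a b :: "nat \<Rightarrow> complex" and n :: nat
  defines "T \<equiv> \<lambda>w l. \<Sum>i=1..n. of_real (dst n l i) * w i"
  shows "(\<Sum>l=1..n. T a l * cnj (T b l)) = of_real ((real n + 1) / 2) * (\<Sum>i=1..n. a i * cnj (b i))"
proof -
  have "(\<Sum>l=1..n. T a l * cnj (T b l))
      = (\<Sum>l=1..n. \<Sum>i=1..n. \<Sum>j=1..n. of_real (dst n l i * dst n l j) * (a i * cnj (b j)))"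
    unfolding T_def cnj_sum sum_product by (simp add: mult_ac)
  also have "\<dots> = (\<Sum>i=1..n. \<Sum>l=1..n. \<Sum>j=1..n. of_real (dst n l i * dst n l j) * (a i * cnj (b j)))"
    by (rule sum.swap)
  also have "\<dots> = (\<Sum>i=1..n. \<Sum>j=1..n. \<Sum>l=1..n. of_real (dst n l i * dst n l j) * (a i * cnj (b j)))"
    by (intro sum.cong refl sum.swap)
  also have "\<dots> = (\<Sum>i=1..n. \<Sum>j=1..n. if j = i then of_real ((real n + 1) / 2) * (a i * cnj (b j)) else 0)"
  proof (intro sum.cong refl)
    fix i j assume ij: "i \<in> {1..n}" "j \<in> {1..n}"
    have "(\<Sum>l=1..n. of_real (dst n l i * dst n l j) * (a i * cnj (b j)))
        = of_real (\<Sum>l=1..n. dst n i l * dst n j l) * (a i * cnj (b j))"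
      by (simp add: sum_distrib_right dst_sym[of n i] dst_sym[of n j])
    also have "(\<Sum>l=1..n. dst n i l * dst n j l) = (if j = i then (real n + 1) / 2 else 0)"
      using ij dst_norm[of i n] dst_orthogonal[of i n j] by auto
    finally show "(\<Sum>l=1..n. of_real (dst n l i * dst n l j) * (a i * cnj (b j)))
        = (if j = i then of_real ((real n + 1) / 2) * (a i * cnj (b j)) else 0)" by simp
  qed
  also have "\<dots> = (\<Sum>i=1..n. of_real ((real n + 1) / 2) * (a i * cnj (b i)))"
    by (intro sum.cong refl) (auto simp: sum.delta)
  finally show ?thesis by (simp add: sum_distrib_left)
qed

text \<open>Summation by parts: forward and backward shift are transposes of each other once the
  boundary terms vanish.\<close>

lemma sum_shift_product:
  fixes a b :: "nat \<Rightarrow> 'a::comm_ring_1"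
  assumes "a 0 = 0" "b (Suc n) = 0"
  shows "(\<Sum>i=1..n. a i * b (Suc i)) = (\<Sum>i=1..n. a (i - 1) * b i)"
proof -
  have "(\<Sum>i=1..N. a i * b (Suc i)) = (\<Sum>i=1..N. a (i - 1) * b i) + a N * b (Suc N)" for N
    by (induction N) (auto simp: assms(1))
  from this[of n] show ?thesis by (simp add: assms(2))
qed

lemma Re_of_real_mult: "Re (of_real r * z) = r * Re z"
  by simp

text \<open>A Rayleigh quotient in the sine basis. The eigenvalues \<open>c l\<close> decrease in
  \<open>l\<close>, and the hypothesis removes the components with \<open>l < k\<close>, so
  \<open>c k\<close> bounds all that remain.\<close>

lemma path_form_le:
  fixes w :: "nat \<Rightarrow> complex"
  assumes w: "w 0 = 0" "w (Suc n) = 0"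
    and orth: "\<And>l. l \<in> {1..<k} \<Longrightarrow> (\<Sum>i=1..n. of_real (dst n l i) * w i) = 0"
  shows "(\<Sum>i=1..n. Re (w (Suc i) * cnj (w i)))
    \<le> cos (real k * pi / (real n + 1)) * (\<Sum>i=1..n. (cmod (w i))\<^sup>2)"
proof -
  define T where "T w l = (\<Sum>i=1..n. of_real (dst n l i) * w i)" for w :: "nat \<Rightarrow> complex" and l
  define c where "c l = cos (real l * pi / (real n + 1))" for l
  define S where "S i = w (Suc i) + w (i - 1)" for i
  let ?h = "(real n + 1) / 2"
  \<comment> \<open>\<open>S\<close> is the adjacency matrix of the path applied to
    \<open>w\<close>. Both shifts are moved onto the sines, where the recurrence applies.\<close>
  have TS: "T S l = of_real (2 * c l) * T w l" for l
  proof -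
    have 1: "(\<Sum>i=1..n. of_real (dst n l i) * w (Suc i)) = (\<Sum>i=1..n. of_real (dst n l (i - 1)) * w i)"
      by (rule sum_shift_product) (simp_all add: dst_0 w)
    have "(\<Sum>i=1..n. w i * of_real (dst n l (Suc i))) = (\<Sum>i=1..n. w (i - 1) * of_real (dst n l i))"
      by (rule sum_shift_product) (simp_all add: dst_Suc_n w)
    then have 2: "(\<Sum>i=1..n. of_real (dst n l i) * w (i - 1)) = (\<Sum>i=1..n. of_real (dst n l (Suc i)) * w i)"
      by (simp add: mult.commute)
    have "T S l = (\<Sum>i=1..n. of_real (dst n l i) * w (Suc i)) + (\<Sum>i=1..n. of_real (dst n l i) * w (i - 1))"
      by (simp add: T_def S_def distrib_left sum.distrib)
    also have "\<dots> = (\<Sum>i=1..n. of_real (dst n l (Suc i) + dst n l (i - 1)) * w i)"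
      unfolding 1 2 by (simp add: distrib_right sum.distrib)
    also have "\<dots> = (\<Sum>i=1..n. of_real (2 * c l * dst n l i) * w i)"
    proof (intro sum.cong refl)
      fix i assume "i \<in> {1..n}"
      then obtain i' where "i = Suc i'" by (cases i) auto
      then show "of_real (dst n l (Suc i) + dst n l (i - 1)) * w i = of_real (2 * c l * dst n l i) * w i"
        using dst_recurrence[of n l i'] by (simp add: c_def del: of_real_add of_real_mult)
    qed
    finally show ?thesis by (simp add: T_def sum_distrib_left mult.assoc)
  qed
  have norm: "T w l * cnj (T w l) = of_real ((cmod (T w l))\<^sup>2)" for l
    by (simp only: complex_norm_square)
  have E: "(\<Sum>l=1..n. (cmod (T w l))\<^sup>2) = ?h * (\<Sum>i=1..n. (cmod (w i))\<^sup>2)"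
  proof -
    have "complex_of_real (\<Sum>l=1..n. (cmod (T w l))\<^sup>2) = (\<Sum>l=1..n. T w l * cnj (T w l))"
      by (simp only: of_real_sum norm)
    also have "\<dots> = of_real ?h * (\<Sum>i=1..n. w i * cnj (w i))"
      unfolding T_def by (rule dst_parseval)
    also have "(\<Sum>i=1..n. w i * cnj (w i)) = of_real (\<Sum>i=1..n. (cmod (w i))\<^sup>2)"
      unfolding of_real_sum complex_norm_square by (rule refl)
    finally have "complex_of_real (\<Sum>l=1..n. (cmod (T w l))\<^sup>2) = of_real (?h * (\<Sum>i=1..n. (cmod (w i))\<^sup>2))"
      by (simp only: of_real_mult)
    then show ?thesis by (simp only: of_real_eq_iff)
  qed
  have "(\<Sum>i=1..n. S i * cnj (w i))
      = (\<Sum>i=1..n. w (Suc i) * cnj (w i)) + (\<Sum>i=1..n. w (i - 1) * cnj (w i))"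
    by (simp add: S_def distrib_right sum.distrib)
  also have "(\<Sum>i=1..n. w (i - 1) * cnj (w i)) = (\<Sum>i=1..n. w i * cnj (w (Suc i)))"
    by (rule sum_shift_product[symmetric]) (simp_all add: w)
  finally have Re_S: "Re (\<Sum>i=1..n. S i * cnj (w i)) = 2 * (\<Sum>i=1..n. Re (w (Suc i) * cnj (w i)))"
    by (simp add: sum_distrib_left mult_ac add_ac sum.distrib)
  have "of_real (\<Sum>l=1..n. 2 * c l * (cmod (T w l))\<^sup>2) = of_real ?h * (\<Sum>i=1..n. S i * cnj (w i))"
    using dst_parseval[of n S w, folded T_def] by (simp add: TS norm mult.assoc)
  from arg_cong[OF this, of Re] have "(\<Sum>l=1..n. 2 * c l * (cmod (T w l))\<^sup>2)
      = ?h * (2 * (\<Sum>i=1..n. Re (w (Suc i) * cnj (w i))))"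
    unfolding Re_S[symmetric] by (simp only: Re_complex_of_real Re_of_real_mult)
  then have Q: "(\<Sum>l=1..n. c l * (cmod (T w l))\<^sup>2) = ?h * (\<Sum>i=1..n. Re (w (Suc i) * cnj (w i)))"
    by (simp only: mult.assoc sum_distrib_left[symmetric])
  have "(\<Sum>l=1..n. c l * (cmod (T w l))\<^sup>2) \<le> (\<Sum>l=1..n. c k * (cmod (T w l))\<^sup>2)"
  proof (rule sum_mono)
    fix l assume l: "l \<in> {1..n}"
    show "c l * (cmod (T w l))\<^sup>2 \<le> c k * (cmod (T w l))\<^sup>2"
    proof (cases "l < k")
      case True
      then have "T w l = 0" using orth l by (simp add: T_def)
      then show ?thesis by simp
    next
      case False
      have "c l \<le> c k" unfolding c_def using False dst_angle_bounds[OF l]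
        by (intro cos_monotone_0_pi_le) (auto simp: divide_right_mono mult_right_mono)
      then show ?thesis by (intro mult_right_mono) auto
    qed
  qed
  also have "\<dots> = ?h * (c k * (\<Sum>i=1..n. (cmod (w i))\<^sup>2))"
    unfolding sum_distrib_left[symmetric] E by simp
  finally have "?h * (\<Sum>i=1..n. Re (w (Suc i) * cnj (w i)))
      \<le> ?h * (c k * (\<Sum>i=1..n. (cmod (w i))\<^sup>2))" by (simp only: Q)
  then show ?thesis unfolding c_def by (rule mult_left_le_imp_le) simp
qed

section \<open>Isotropic vectors of a scalar KMS matrix\<close>

definition kms_form :: "nat \<Rightarrow> complex \<Rightarrow> (nat \<Rightarrow> complex) \<Rightarrow> (nat \<Rightarrow> complex) \<Rightarrow> complex" where
  "kms_form m d x y = (\<Sum>i<m. \<Sum>j<m. if i < j then d ^ (j - i) * x j * cnj (y i) else 0)"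

text \<open>Row \<open>i\<close> of the KMS matrix applied to (I - r N) u. The boundary term is the
  reason for requiring \<open>u m = 0\<close> afterwards.\<close>

lemma geometric_telescope:
  fixes r :: "'a::comm_ring_1"
  assumes "Suc i \<le> m"
  shows "(\<Sum>j<m. if i < j then r ^ (j - i) * (u j - r * u (Suc j)) else 0)
    = r * u (Suc i) - r ^ (m - i) * u m"
  using assms
proof (induction m rule: dec_induct)
  case base
  have "(\<Sum>j<Suc i. if i < j then r ^ (j - i) * (u j - r * u (Suc j)) else 0) = 0"
    by (rule sum.neutral) auto
  then show ?case by simp
next
  case (step m)
  then have "Suc m - i = Suc (m - i)" by simp
  with step show ?case by (simp add: algebra_simps)
qed

text \<open>Substituting \<open>x = (I - r N) u\<close> with the nilpotent shift \<open>N\<close> turns the full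
  upper triangular form into a bidiagonal one, because the KMS matrix is \<open>r N (I - r N)\<^sup>-\<^sup>1\<close>.\<close>

lemma kms_form_resolvent:
  assumes x: "\<And>j. j < m \<Longrightarrow> x j = u j - r * u (Suc j)" and u: "u m = 0"
  shows "kms_form m r x y = (\<Sum>i<m. r * u (Suc i) * cnj (y i))"
  unfolding kms_form_def
proof (rule sum.cong)
  fix i assume "i \<in> {..<m}"
  then have i: "Suc i \<le> m" by simp
  have "(\<Sum>j<m. if i < j then r ^ (j - i) * x j * cnj (y i) else 0)
      = (\<Sum>j<m. if i < j then r ^ (j - i) * (u j - r * u (Suc j)) else 0) * cnj (y i)"
    unfolding sum_distrib_right by (intro sum.cong) (auto simp: x)
  then show "(\<Sum>j<m. if i < j then r ^ (j - i) * x j * cnj (y i) else 0) = r * u (Suc i) * cnj (y i)"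
    by (simp add: geometric_telescope[OF i] u)
qed simp

text \<open>Conjugation by the diagonal unitary with entries \<open>c ^ j\<close> multiplies entry
  (i, j) by \<open>c ^ (j - i)\<close>.\<close>

lemma kms_form_phase:
  assumes "c * cnj c = 1"
  shows "kms_form m (r * c) x y = kms_form m r (\<lambda>j. c ^ j * x j) (\<lambda>j. c ^ j * y j)"
  unfolding kms_form_def
proof (intro sum.cong refl)
  fix i j
  have "c ^ (j - i) = c ^ j * cnj (c ^ i)" if "i < j"
  proof -
    have "c ^ j * cnj (c ^ i) = c ^ (j - i) * (c * cnj c) ^ i"
      using that by (simp add: power_mult_distrib mult.assoc[symmetric] power_add[symmetric])
    then show ?thesis by (simp add: assms)
  qed
  then show "(if i < j then (r * c) ^ (j - i) * x j * cnj (y i) else 0)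
      = (if i < j then r ^ (j - i) * (c ^ j * x j) * cnj (c ^ i * y i) else 0)"
    by (simp add: power_mult_distrib mult_ac)
qed

text \<open>The relation for \<open>j + 1\<close> minus \<open>t l0\<close> times the relation for
  \<open>j\<close> eliminates \<open>l0\<close> and multiplies the other coefficients by nonzero
  differences.\<close>

lemma vandermonde_zero:
  fixes a t :: "'i \<Rightarrow> 'a::idom"
  assumes "finite L" "inj_on t L" "\<And>j. (\<Sum>l\<in>L. a l * t l ^ j) = 0"
  shows "\<forall>l\<in>L. a l = 0"
  using assms
proof (induction L arbitrary: a rule: finite_induct)
  case (insert l0 L)
  have "(\<Sum>l\<in>L. (a l * (t l - t l0)) * t l ^ j) = 0" for j
  proof -
    have "(\<Sum>l\<in>L. (a l * (t l - t l0)) * t l ^ j) = (\<Sum>l\<in>insert l0 L. (a l * (t l - t l0)) * t l ^ j)"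
      using insert.hyps by simp
    also have "\<dots> = (\<Sum>l\<in>insert l0 L. a l * t l ^ Suc j) - t l0 * (\<Sum>l\<in>insert l0 L. a l * t l ^ j)"
      unfolding sum_distrib_left sum_subtractf[symmetric]
      by (intro sum.cong) (auto simp: algebra_simps)
    also have "\<dots> = 0" by (simp only: insert.prems(2)) simp
    finally show ?thesis .
  qed
  then have *: "\<forall>l\<in>L. a l * (t l - t l0) = 0" using insert.prems(1) by (intro insert.IH) auto
  have L: "\<forall>l\<in>L. a l = 0"
  proof
    fix l assume l: "l \<in> L"
    with insert.hyps insert.prems(1) have "t l \<noteq> t l0" by (auto simp: inj_on_def)
    with * l show "a l = 0" by auto
  qed
  moreover have "a l0 = 0" using insert.prems(2)[of 0] insert.hyps L by simp
  ultimately show ?case by simp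
qed simp

text \<open>The sequences \<open>x\<^sub>l = (\<mu>\<^sub>l\<^sup>i sin (i l \<pi> / (n + 1)))\<^sub>i\<close> are eigenvectors of the pencil
  \<open>(N - r, N\<^sup>T - r)\<close> with eigenvalue \<open>-\<mu>\<^sub>l\<^sup>2\<close>, and the larger root \<open>\<mu>\<^sub>l\<close> of
  \<open>r (1 + \<mu>\<^sup>2) = 2 \<mu> cos (l \<pi> / (n + 1))\<close> is at least 1. Hence the numbers
  \<open>b(l, l') = x\<^sub>l\<^sup>T (N\<^sup>T - r) x\<^sub>l'\<close> satisfy \<open>b(l, l') = (\<mu>\<^sub>l \<mu>\<^sub>l')\<^sup>2 b(l, l')\<close>, which forces them to
  vanish. In the coordinates \<open>u\<close> the isotropic subspace is spanned by \<open>e\<^sub>0\<close> and the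
  \<open>(0, 0, x\<^sub>l)\<close> with \<open>1 \<le> l < k\<close>.\<close>

locale kms_scalar =
  fixes n k :: nat and r :: real
  assumes r_pos: "0 < r" and k_bounds: "1 \<le> k" "k \<le> n"
begin

definition angle_cos :: "nat \<Rightarrow> real" where
  "angle_cos l = cos (real l * pi / (real n + 1))"

definition mu :: "nat \<Rightarrow> real" where
  "mu l = (angle_cos l + sqrt ((angle_cos l)\<^sup>2 - r\<^sup>2)) / r"

definition pencil_vec :: "nat \<Rightarrow> nat \<Rightarrow> real" where
  "pencil_vec l i = mu l ^ i * dst n l i"

lemma pencil_vec_0: "pencil_vec l 0 = 0"
  by (simp add: pencil_vec_def dst_0)

lemma pencil_vec_Suc_n: "pencil_vec l (Suc n) = 0"
  by (simp add: pencil_vec_def dst_Suc_n)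

lemma angle_cos_inj:
  assumes "l \<in> {1..n}" "l' \<in> {1..n}" "angle_cos l = angle_cos l'"
  shows "l = l'"
proof -
  have "real l * pi / (real n + 1) = real l' * pi / (real n + 1)"
    using assms(3) dst_angle_bounds[OF assms(1)] dst_angle_bounds[OF assms(2)]
    unfolding angle_cos_def by (metis cos_inj_pi less_imp_le)
  moreover have "real n + 1 \<noteq> 0" by linarith
  ultimately show ?thesis by simp
qed

context
  assumes r_le: "\<And>l. l \<in> {1..<k} \<Longrightarrow> r \<le> angle_cos l"
begin

lemma mu_props:
  assumes "l \<in> {1..<k}"
  shows "1 \<le> mu l" "r * (1 + (mu l)\<^sup>2) = 2 * mu l * angle_cos l"
proof -
  define s where "s = sqrt ((angle_cos l)\<^sup>2 - r\<^sup>2)"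
  have "r\<^sup>2 \<le> (angle_cos l)\<^sup>2" using r_le[OF assms] r_pos by (intro power_mono) auto
  then have s: "0 \<le> s" "s\<^sup>2 = (angle_cos l)\<^sup>2 - r\<^sup>2" by (auto simp: s_def)
  have m: "r * mu l = angle_cos l + s" using r_pos by (simp add: mu_def s_def)
  then have "r * 1 \<le> r * mu l" using r_le[OF assms] s by simp
  then show "1 \<le> mu l" using r_pos by simp
  have "r * (r * (1 + (mu l)\<^sup>2)) = r\<^sup>2 + (r * mu l)\<^sup>2"
    by (simp add: power2_eq_square algebra_simps)
  also have "\<dots> = 2 * (r * mu l) * angle_cos l"
    unfolding m using s(2) by (simp add: power2_eq_square algebra_simps)
  also have "\<dots> = r * (2 * mu l * angle_cos l)" by simp
  finally show "r * (1 + (mu l)\<^sup>2) = 2 * mu l * angle_cos l"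
    using r_pos by (simp only: mult_cancel_left) auto
qed

text \<open>Origin of the factor \<open>mu l ^ i\<close>: the pencil equation reads x_(i+1) + mu^2
  x_(i-1) = r (1 + mu^2) x_i, and x_i = mu^i s_i turns it into the sine recurrence exactly when r
  (mu + 1/mu) is twice the cosine.\<close>

lemma pencil_vec_recurrence:
  assumes l: "l \<in> {1..<k}" and "i \<ge> 1"
  shows "pencil_vec l (Suc i) - r * pencil_vec l i = - (mu l)\<^sup>2 * (pencil_vec l (i - 1) - r * pencil_vec l i)"
proof -
  obtain i' where i': "i = Suc i'" using \<open>i \<ge> 1\<close> by (cases i) auto
  have "pencil_vec l (Suc i) + (mu l)\<^sup>2 * pencil_vec l i' = mu l ^ Suc i * (dst n l (Suc (Suc i')) + dst n l i')"
    unfolding i' pencil_vec_def by (simp add: power2_eq_square algebra_simps)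
  also have "\<dots> = 2 * mu l * angle_cos l * pencil_vec l i"
    unfolding dst_recurrence i' pencil_vec_def angle_cos_def by simp
  also have "\<dots> = r * (1 + (mu l)\<^sup>2) * pencil_vec l i" by (simp only: mu_props(2)[OF l])
  finally show ?thesis unfolding i' by (simp add: algebra_simps)
qed

lemma mu_inj:
  assumes "l \<in> {1..<k}" "l' \<in> {1..<k}" "mu l = mu l'"
  shows "l = l'"
proof -
  have "2 * mu l * angle_cos l = 2 * mu l * angle_cos l'"
    using mu_props(2)[OF assms(1)] mu_props(2)[OF assms(2)] assms(3) by auto
  moreover have "mu l \<noteq> 0" using mu_props(1)[OF assms(1)] by simp
  ultimately have "angle_cos l = angle_cos l'" by simp
  then show ?thesis using assms k_bounds by (intro angle_cos_inj) auto
qed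

definition bform :: "nat \<Rightarrow> nat \<Rightarrow> real" where
  "bform l l' = (\<Sum>i=1..n. pencil_vec l i * (pencil_vec l' (i - 1) - r * pencil_vec l' i))"

text \<open>Transposing the shift moves it from one vector to the other, and the pencil equation of
  \<open>l'\<close> converts the forward shift back into the backward one.\<close>

lemma bform_swap:
  assumes l': "l' \<in> {1..<k}"
  shows "bform l' l = - (mu l')\<^sup>2 * bform l l'"
proof -
  have "bform l' l = (\<Sum>i=1..n. pencil_vec l (i - 1) * pencil_vec l' i) - r * (\<Sum>i=1..n. pencil_vec l' i * pencil_vec l i)"
    unfolding bform_def sum_distrib_left sum_subtractf[symmetric]
    by (intro sum.cong) (auto simp: algebra_simps)
  also have "(\<Sum>i=1..n. pencil_vec l (i - 1) * pencil_vec l' i) = (\<Sum>i=1..n. pencil_vec l i * pencil_vec l' (Suc i))"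
    by (rule sum_shift_product[symmetric]) (simp_all add: pencil_vec_0 pencil_vec_Suc_n)
  also have "\<dots> - r * (\<Sum>i=1..n. pencil_vec l' i * pencil_vec l i)
      = (\<Sum>i=1..n. pencil_vec l i * (pencil_vec l' (Suc i) - r * pencil_vec l' i))"
    unfolding sum_distrib_left sum_subtractf[symmetric]
    by (intro sum.cong) (auto simp: algebra_simps)
  also have "\<dots> = (\<Sum>i=1..n. - (mu l')\<^sup>2 * (pencil_vec l i * (pencil_vec l' (i - 1) - r * pencil_vec l' i)))"
  proof (rule sum.cong)
    fix i assume "i \<in> {1..n}"
    then have "i \<ge> 1" by simp
    show "pencil_vec l i * (pencil_vec l' (Suc i) - r * pencil_vec l' i) = - (mu l')\<^sup>2 * (pencil_vec l i * (pencil_vec l' (i - 1) - r * pencil_vec l' i))"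
      unfolding pencil_vec_recurrence[OF l' \<open>i \<ge> 1\<close>] by (simp only: mult_ac)
  qed simp
  finally show ?thesis by (simp only: bform_def sum_distrib_left)
qed

lemma bform_0:
  assumes l: "l \<in> {1..<k}" "l' \<in> {1..<k}"
  shows "bform l l' = 0"
proof (rule ccontr)
  assume nz: "bform l l' \<noteq> 0"
  have "bform l l' = (mu l)\<^sup>2 * (mu l')\<^sup>2 * bform l l'"
    using bform_swap[OF l(1), of l'] bform_swap[OF l(2), of l] by simp
  with nz have "(mu l * mu l')\<^sup>2 = 1" by (simp add: power_mult_distrib)
  moreover have m: "1 \<le> mu l" "1 \<le> mu l'" using l by (auto intro: mu_props)
  ultimately have "mu l * mu l' = 1"
    by (smt (verit, best) mult_pos_pos power2_eq_1_iff)
  moreover have "mu l \<le> mu l * mu l'" "mu l' \<le> mu l * mu l'"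
    using m mult_left_mono[of 1 "mu l'" "mu l"] mult_right_mono[of 1 "mu l" "mu l'"] by auto
  \<comment> \<open>Only the double root remains, where \<open>r\<close> equals the cosine. There
    the swap identity says that \<open>bform l l\<close> is its own negative.\<close>
  ultimately have mu1: "mu l = 1" "mu l' = 1" using m by auto
  then have "l = l'" using mu_inj[OF l] by simp
  then show False using bform_swap[OF l(2), of l] mu1 nz by simp
qed

definition shifted_pencil_vec :: "nat \<Rightarrow> nat \<Rightarrow> complex" where
  "shifted_pencil_vec l p = (case p of 0 \<Rightarrow> if l = 0 then 1 else 0 | Suc i \<Rightarrow> if l = 0 then 0 else of_real (pencil_vec l i))"

definition isotropic_vec :: "nat \<Rightarrow> nat \<Rightarrow> complex" where
  "isotropic_vec l p = shifted_pencil_vec l p - of_real r * shifted_pencil_vec l (Suc p)"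

lemma shifted_pencil_vec_top: "shifted_pencil_vec l (n + 2) = 0"
  by (simp add: shifted_pencil_vec_def pencil_vec_Suc_n)

text \<open>Pairings with e_0 vanish because every shifted pencil vector has u_1 = 0; the other
  pairings equal \<open>r * bform a b\<close>.\<close>

lemma kms_form_isotropic_vec:
  assumes ab: "a < k" "b < k"
  shows "kms_form (n + 2) (of_real r) (isotropic_vec a) (isotropic_vec b) = 0"
proof -
  have form: "kms_form (n + 2) (of_real r) (isotropic_vec a) (isotropic_vec b)
      = (\<Sum>i<n + 2. of_real r * shifted_pencil_vec a (Suc i) * cnj (isotropic_vec b i))"
    by (rule kms_form_resolvent) (simp_all add: isotropic_vec_def shifted_pencil_vec_top del: add_2_eq_Suc')
  consider "a = 0" | "a > 0" "b = 0" | "a > 0" "b > 0" by auto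
  then show ?thesis
  proof cases
    case 1
    then show ?thesis unfolding form by (simp add: shifted_pencil_vec_def)
  next
    case 2
    have "shifted_pencil_vec a (Suc i) * cnj (isotropic_vec b i) = 0" for i
      using 2 by (cases i) (auto simp: shifted_pencil_vec_def isotropic_vec_def pencil_vec_0)
    then show ?thesis unfolding form mult.assoc by (intro sum.neutral) simp
  next
    case 3
    have "(\<Sum>i<n + 2. of_real r * shifted_pencil_vec a (Suc i) * cnj (isotropic_vec b i))
        = (\<Sum>i\<in>{1..n}. of_real r * shifted_pencil_vec a (Suc i) * cnj (isotropic_vec b i))"
    proof (rule sum.mono_neutral_right)
      show "\<forall>i\<in>{..<n + 2} - {1..n}. of_real r * shifted_pencil_vec a (Suc i) * cnj (isotropic_vec b i) = 0"
      proof
        fix i assume "i \<in> {..<n + 2} - {1..n}"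
        then have "i = 0 \<or> i = Suc n" by auto
        then show "of_real r * shifted_pencil_vec a (Suc i) * cnj (isotropic_vec b i) = 0"
          by (auto simp: shifted_pencil_vec_def pencil_vec_0 pencil_vec_Suc_n)
      qed
    qed auto
    also have "\<dots> = of_real (r * bform a b)"
      unfolding bform_def sum_distrib_left of_real_sum
    proof (rule sum.cong)
      fix i assume "i \<in> {1..n}"
      then obtain i' where "i = Suc i'" by (cases i) auto
      then show "of_real r * shifted_pencil_vec a (Suc i) * cnj (isotropic_vec b i)
          = of_real (r * (pencil_vec a i * (pencil_vec b (i - 1) - r * pencil_vec b i)))"
        using 3 by (simp add: shifted_pencil_vec_def isotropic_vec_def)
    qed simp
    finally show ?thesis unfolding form using 3 ab bform_0[of a b] by simp
  qed
qed

text \<open>Eigenvectors of a pencil for distinct eigenvalues: the linear relation stays valid when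
  its coefficients are multiplied by powers of \<open>(mu l)\<^sup>2\<close>, and a Vandermonde
  argument separates the terms.\<close>

lemma lin_indep_isotropic_vec: "lin_indep (n + 2) {..<k} isotropic_vec"
  unfolding lin_indep_def
proof (intro allI impI)
  fix c assume c: "\<forall>p<n + 2. (\<Sum>l<k. c l * isotropic_vec l p) = 0"
  define u where "u p = (\<Sum>l<k. c l * shifted_pencil_vec l p)" for p
  have step: "u p = of_real r * u (Suc p)" if "p < n + 2" for p
  proof -
    have "(\<Sum>l<k. c l * isotropic_vec l p) = u p - of_real r * u (Suc p)"
      unfolding u_def sum_distrib_left sum_subtractf[symmetric] isotropic_vec_def
      by (intro sum.cong) (auto simp: algebra_simps)
    then show ?thesis using c that by simp
  qed
  have u0: "u p = 0" if "p \<le> n + 2" for p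
    using that
  proof (induction p rule: inc_induct)
    case base
    show ?case unfolding u_def shifted_pencil_vec_top by simp
  next
    case (step p)
    then show ?case using \<open>\<And>p. p < n + 2 \<Longrightarrow> u p = of_real r * u (Suc p)\<close>[of p] by simp
  qed
  have k: "{..<k} = insert 0 {1..<k}" using k_bounds by auto
  have c0: "c 0 = 0"
  proof -
    have "u 0 = c 0" unfolding u_def k by (simp add: shifted_pencil_vec_def)
    then show ?thesis using u0[of 0] by simp
  qed
  have X: "(\<Sum>l\<in>{1..<k}. c l * of_real (pencil_vec l i)) = 0" if "i \<le> n + 1" for i
  proof -
    have "u (Suc i) = (\<Sum>l\<in>{1..<k}. c l * of_real (pencil_vec l i))" unfolding u_def k by (simp add: shifted_pencil_vec_def)
    then show ?thesis using u0[of "Suc i"] that by simp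
  qed
  have S: "\<forall>i\<le>n + 1. (\<Sum>l\<in>{1..<k}. c l * of_real ((mu l)\<^sup>2) ^ j * of_real (pencil_vec l i)) = 0" for j
  proof (induction j)
    case 0
    then show ?case using X by simp
  next
    case (Suc j)
    define S where "S j i = (\<Sum>l\<in>{1..<k}. c l * of_real ((mu l)\<^sup>2) ^ j * of_real (pencil_vec l i))" for j i
    have IH: "S j i = 0" if "i \<le> n + 1" for i using Suc that by (simp add: S_def)
    have neg: "S j (Suc i) - of_real r * S j i = - (S (Suc j) (i - 1) - of_real r * S (Suc j) i)"
      if "i \<ge> 1" for i
    proof -
      have "S j (Suc i) - of_real r * S j i
          = (\<Sum>l\<in>{1..<k}. c l * of_real ((mu l)\<^sup>2) ^ j * of_real (pencil_vec l (Suc i) - r * pencil_vec l i))"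
        unfolding S_def sum_distrib_left sum_subtractf[symmetric]
        by (intro sum.cong) (auto simp: algebra_simps)
      also have "\<dots> = (\<Sum>l\<in>{1..<k}. - (c l * of_real ((mu l)\<^sup>2) ^ Suc j * of_real (pencil_vec l (i - 1) - r * pencil_vec l i)))"
      proof (rule sum.cong)
        fix l assume l: "l \<in> {1..<k}"
        show "c l * of_real ((mu l)\<^sup>2) ^ j * of_real (pencil_vec l (Suc i) - r * pencil_vec l i)
            = - (c l * of_real ((mu l)\<^sup>2) ^ Suc j * of_real (pencil_vec l (i - 1) - r * pencil_vec l i))"
          unfolding pencil_vec_recurrence[OF l that] by simp
      qed simp
      also have "\<dots> = - (S (Suc j) (i - 1) - of_real r * S (Suc j) i)"
        unfolding S_def sum_distrib_left sum_subtractf[symmetric] sum_negf[symmetric]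
        by (intro sum.cong) (auto simp: algebra_simps)
      finally show ?thesis .
    qed
    \<comment> \<open>N - r applied to relation \<open>j\<close> is, up to sign, N^T - r applied to
      relation \<open>j + 1\<close>. The latter matrix is triangular with diagonal -r, hence
      injective, and zero propagates upwards from index 0.\<close>
    have rec: "S (Suc j) (i - 1) = of_real r * S (Suc j) i" if "i \<in> {1..n}" for i
    proof -
      have that': "i \<ge> 1" using that by simp
      have "S j (Suc i) - of_real r * S j i = 0" using IH[of i] IH[of "Suc i"] that by simp
      then show ?thesis unfolding neg[OF that'] by simp
    qed
    have "S (Suc j) i = 0" if "i \<le> n" for i
      using that
    proof (induction i)
      case 0
      then show ?case by (simp add: S_def pencil_vec_0)
    next
      case (Suc i)
      then show ?case using rec[of "Suc i"] r_pos by simp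
    qed
    moreover have "S (Suc j) (n + 1) = 0" by (simp add: S_def pencil_vec_Suc_n)
    ultimately have "S (Suc j) i = 0" if "i \<le> n + 1" for i
      using that by (cases "i = n + 1") auto
    then show ?case by (simp add: S_def)
  qed
  have "\<forall>l\<in>{1..<k}. c l * of_real (pencil_vec l 1) = 0"
  proof (rule vandermonde_zero)
    show "inj_on (\<lambda>l. complex_of_real ((mu l)\<^sup>2)) {1..<k}"
    proof (rule inj_onI)
      fix l l' assume l: "l \<in> {1..<k}" "l' \<in> {1..<k}"
        and "complex_of_real ((mu l)\<^sup>2) = complex_of_real ((mu l')\<^sup>2)"
      then have sq: "(mu l)\<^sup>2 = (mu l')\<^sup>2" by (simp only: of_real_eq_iff)
      have "0 \<le> mu l" "0 \<le> mu l'" using mu_props(1)[OF l(1)] mu_props(1)[OF l(2)] by linarith+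
      with sq have "mu l = mu l'" by (rule power2_eq_imp_eq)
      then show "l = l'" by (rule mu_inj[OF l])
    qed
    show "(\<Sum>l\<in>{1..<k}. c l * of_real (pencil_vec l 1) * of_real ((mu l)\<^sup>2) ^ j) = 0" for j
    proof -
      have "(\<Sum>l\<in>{1..<k}. c l * of_real (pencil_vec l 1) * of_real ((mu l)\<^sup>2) ^ j)
        = (\<Sum>l\<in>{1..<k}. c l * of_real ((mu l)\<^sup>2) ^ j * of_real (pencil_vec l 1))"
        by (intro sum.cong refl) (simp only: mult_ac)
      also have "\<dots> = 0" by (rule S[of j, rule_format]) simp
      finally show ?thesis .
    qed
  qed simp
  moreover have "pencil_vec l 1 \<noteq> 0" if l: "l \<in> {1..<k}" for l
  proof -
    have "l \<in> {1..n}" using l k_bounds by auto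
    from dst_angle_bounds[OF this] have "0 < sin (real l * pi / (real n + 1))"
      by (rule sin_gt_zero)
    then show ?thesis using mu_props(1)[OF l] by (simp add: pencil_vec_def dst_def)
  qed
  ultimately show "\<forall>l\<in>{..<k}. c l = 0" unfolding k using c0 by simp
qed

end

end

section \<open>Negative definiteness on the kernel of few functionals\<close>

text \<open>Pulls a functional given in the coordinates \<open>u\<close> back to the coordinates
  \<open>x\<close>.\<close>

lemma linear_combination_coefficients:
  fixes g :: "nat \<Rightarrow> 'a::comm_semiring_1"
  assumes "\<And>p. u p = (\<Sum>q<m. T p q * x q)"
  shows "(\<Sum>p<m. g p * u p) = (\<Sum>q<m. (\<Sum>p<m. g p * T p q) * x q)"
proof -
  have "(\<Sum>p<m. g p * u p) = (\<Sum>p<m. \<Sum>q<m. g p * T p q * x q)"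
    by (simp add: assms sum_distrib_left mult.assoc)
  also have "\<dots> = (\<Sum>q<m. \<Sum>p<m. g p * T p q * x q)" by (rule sum.swap)
  finally show ?thesis by (simp add: sum_distrib_right)
qed

text \<open>\<open>u\<close> is the finite Neumann series of (I - r N)^(-1) x, so this inverts the
  substitution behind the bidiagonal form.\<close>

lemma resolvent_difference:
  fixes x :: "nat \<Rightarrow> 'a::comm_ring_1" and r :: 'a and m :: nat
  defines "u \<equiv> \<lambda>p. \<Sum>q<m. (if p \<le> q then r ^ (q - p) else 0) * x q"
  assumes "p < m"
  shows "x p = u p - r * u (Suc p)"
proof -
  have "u p - r * u (Suc p) = (\<Sum>q<m. if q = p then x q else 0)"
    unfolding u_def sum_distrib_left sum_subtractf[symmetric]
  proof (rule sum.cong)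
    fix q
    consider "q < p" | "q = p" | "p < q" by linarith
    then show "(if p \<le> q then r ^ (q - p) else 0) * x q
        - r * ((if Suc p \<le> q then r ^ (q - Suc p) else 0) * x q) = (if q = p then x q else 0)"
    proof cases
      case 3
      then have "q - p = Suc (q - Suc p)" by simp
      with 3 show ?thesis by (simp add: mult.assoc)
    qed auto
  qed simp
  then show ?thesis using \<open>p < m\<close> by (simp add: sum.delta)
qed

context kms_scalar
begin

text \<open>In the coordinates \<open>u\<close>, the functional with index 0 imposes \<open>u\<^sub>0 = - C u\<^sub>1\<close> with \<open>C\<close> large enough
  to absorb the cross term \<open>u\<^sub>2 cnj(u\<^sub>1)\<close>; the others make \<open>(u\<^sub>2, \<dots>, u\<^bsub>n+1\<^esub>)\<close> orthogonal to the first
  \<open>k - 1\<close> eigenvectors of the path.\<close>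

definition upper_weight :: "nat \<Rightarrow> nat \<Rightarrow> complex" where
  "upper_weight l p = (if l = 0 then (if p = 0 then 1 else if p = 1 then of_real (1 / (r - angle_cos k)) else 0)
     else if 2 \<le> p then of_real (dst n l (p - 1)) else 0)"

definition upper_functional :: "nat \<Rightarrow> nat \<Rightarrow> complex" where
  "upper_functional l q = (\<Sum>p<n + 2. upper_weight l p * (if p \<le> q then of_real r ^ (q - p) else 0))"

text \<open>The orthogonality conditions push the shifted path form of \<open>w\<close> below
  \<open>- \<delta> * E\<close>, and the condition on \<open>u 0\<close> yields
  \<open>- C * a\<^sup>2\<close>. Half of each pays for the cross term between \<open>u 1\<close>
  and \<open>w 1\<close>; the other halves keep the form strictly negative.\<close>

lemma Re_kms_form_neg:
  assumes r: "angle_cos k < r"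
    and zero: "\<And>l. l < k \<Longrightarrow> (\<Sum>q<n + 2. upper_functional l q * x q) = 0"
    and nz: "\<exists>q<n + 2. x q \<noteq> 0"
  shows "Re (kms_form (n + 2) (of_real r) x x) < 0"
proof -
  define u where "u p = (\<Sum>q<n + 2. (if p \<le> q then of_real r ^ (q - p) else 0) * x q)" for p
  have x_u: "x p = u p - of_real r * u (Suc p)" if "p < n + 2" for p
    unfolding u_def by (rule resolvent_difference[OF that])
  have u_top: "u (Suc (Suc n)) = 0" unfolding u_def by (rule sum.neutral) auto
  have "(\<Sum>p<n + 2. upper_weight l p * u p) = 0" if "l < k" for l
    using linear_combination_coefficients[where g = "upper_weight l" and u = u, OF u_def] zero[OF that]
    unfolding upper_functional_def by simp
  note weights = this
  define C where "C = 1 / (r - angle_cos k)"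
  \<comment> \<open>The path starts at \<open>u 2\<close>. Setting \<open>w 0 = 0\<close> instead of
    \<open>u 1\<close> cuts the edge between \<open>u 1\<close> and \<open>u 2\<close>, whose
    contribution is carried separately as \<open>Re (w 1 * cnj (u 1))\<close>.\<close>
  define w where "w i = (if i = 0 then 0 else u (Suc i))" for i
  have u0: "u 0 = - of_real C * u 1"
  proof -
    have "(\<Sum>p<n + 2. upper_weight 0 p * u p) = (\<Sum>p\<in>{0, 1}. upper_weight 0 p * u p)"
      by (rule sum.mono_neutral_right) (auto simp: upper_weight_def)
    also have "\<dots> = u 0 + of_real C * u 1" by (simp add: upper_weight_def C_def)
    finally have "u 0 + of_real C * u 1 = 0" using weights[of 0] k_bounds by simp
    then show ?thesis by (simp add: eq_neg_iff_add_eq_0)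
  qed
  have orth: "(\<Sum>i=1..n. of_real (dst n l i) * w i) = 0" if "l \<in> {1..<k}" for l
  proof -
    have "(\<Sum>p<n + 2. upper_weight l p * u p) = (\<Sum>p\<in>Suc ` {1..n}. upper_weight l p * u p)"
    proof (rule sum.mono_neutral_right)
      show "\<forall>p\<in>{..<n + 2} - Suc ` {1..n}. upper_weight l p * u p = 0"
      proof
        fix p assume p: "p \<in> {..<n + 2} - Suc ` {1..n}"
        have "p < 2"
        proof (rule ccontr)
          assume "\<not> p < 2"
          then have "p = Suc (p - 1)" "p - 1 \<in> {1..n}" using p by auto
          then show False using p by (metis DiffD2 imageI)
        qed
        then show "upper_weight l p * u p = 0" using that by (simp add: upper_weight_def)
      qed
    qed auto
    also have "\<dots> = (\<Sum>i=1..n. upper_weight l (Suc i) * u (Suc i))"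
      by (subst sum.reindex) (auto simp: inj_on_def)
    also have "\<dots> = (\<Sum>i=1..n. of_real (dst n l i) * w i)"
      using that by (intro sum.cong) (auto simp: upper_weight_def w_def)
    finally show ?thesis using weights[of l] that by simp
  qed
  define E where "E = (\<Sum>i=1..n. (cmod (w i))\<^sup>2)"
  define P where "P = (\<Sum>i=1..n. Re (w (Suc i) * cnj (w i)))"
  have P_le: "P \<le> angle_cos k * E"
    unfolding P_def E_def angle_cos_def
    by (rule path_form_le[OF _ _ orth]) (auto simp: w_def u_top)
  have summand: "Re (of_real r * u (Suc i) * cnj (x i)) = r * (Re (u (Suc i) * cnj (u i)) - r * (cmod (u (Suc i)))\<^sup>2)"
    if "i < n + 2" for i
  proof -
    have "of_real r * u (Suc i) * cnj (x i)
        = of_real r * (u (Suc i) * cnj (u i) - of_real r * (u (Suc i) * cnj (u (Suc i))))"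
      unfolding x_u[OF that] by (simp add: algebra_simps)
    also have "\<dots> = of_real r * (u (Suc i) * cnj (u i) - of_real (r * (cmod (u (Suc i)))\<^sup>2))"
      by (simp only: complex_norm_square of_real_mult)
    finally show ?thesis by (simp only: Re_of_real_mult minus_complex.sel Re_complex_of_real)
  qed
  have "kms_form (n + 2) (of_real r) x x = (\<Sum>i<n + 2. of_real r * u (Suc i) * cnj (x i))"
    by (rule kms_form_resolvent) (use x_u u_top in auto)
  then have "Re (kms_form (n + 2) (of_real r) x x)
      = (\<Sum>i<n + 2. r * (Re (u (Suc i) * cnj (u i)) - r * (cmod (u (Suc i)))\<^sup>2))"
    by (simp only: Re_sum) (intro sum.cong refl summand, simp)
  also have "\<dots> = r * ((Re (u 1 * cnj (u 0)) - r * (cmod (u 1))\<^sup>2)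
      + (\<Sum>i=1..n. Re (u (Suc i) * cnj (u i)) - r * (cmod (u (Suc i)))\<^sup>2))"
  proof -
    have "{..<n + 2} = insert 0 (insert (Suc n) {1..n})" by auto
    then show ?thesis by (simp add: u_top sum_distrib_left distrib_left)
  qed
  also have "(\<Sum>i=1..n. Re (u (Suc i) * cnj (u i)) - r * (cmod (u (Suc i)))\<^sup>2)
      = Re (w 1 * cnj (u 1)) + P - r * E"
  proof -
    have "(\<Sum>i=1..n. Re (u (Suc i) * cnj (u i))) = Re (w 1 * cnj (u 1)) + P"
    proof -
      obtain n' where n': "n = Suc n'" using k_bounds by (cases n) auto
      have "(\<Sum>i=1..n. Re (u (Suc i) * cnj (u i)))
          = Re (u 2 * cnj (u 1)) + (\<Sum>i=1..n'. Re (u (Suc (Suc i)) * cnj (u (Suc i))))"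
        unfolding n' by (induction n') (simp_all add: numeral_2_eq_2)
      moreover have "P = (\<Sum>i=1..n'. Re (u (Suc (Suc i)) * cnj (u (Suc i))))"
        unfolding P_def n' using u_top by (simp add: w_def n')
      ultimately show ?thesis by (simp add: w_def numeral_2_eq_2)
    qed
    moreover have "E = (\<Sum>i=1..n. (cmod (u (Suc i)))\<^sup>2)"
      unfolding E_def by (intro sum.cong) (auto simp: w_def)
    ultimately show ?thesis by (simp only: sum_subtractf sum_distrib_left)
  qed
  finally have form: "Re (kms_form (n + 2) (of_real r) x x)
      = r * ((Re (u 1 * cnj (u 0)) - r * (cmod (u 1))\<^sup>2) + (Re (w 1 * cnj (u 1)) + P - r * E))" .
  define \<delta> where "\<delta> = r - angle_cos k"
  have \<delta>: "\<delta> > 0" "C = 1 / \<delta>" using r by (auto simp: \<delta>_def C_def)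
  define a where "a = cmod (u 1)"
  define b where "b = cmod (w 1)"
  have "Re (u 1 * cnj (u 0)) = - C * a\<^sup>2"
  proof -
    have "u 1 * cnj (u 0) = of_real (- C) * (u 1 * cnj (u 1))" unfolding u0 by simp
    also have "\<dots> = of_real (- C * a\<^sup>2)" unfolding a_def by (simp only: complex_norm_square of_real_mult)
    finally show ?thesis by (simp only: Re_complex_of_real)
  qed
  moreover have "Re (w 1 * cnj (u 1)) \<le> a * b"
    using complex_Re_le_cmod[of "w 1 * cnj (u 1)"] by (simp add: norm_mult a_def b_def mult.commute)
  moreover have "b\<^sup>2 \<le> E"
    unfolding E_def b_def using k_bounds by (intro member_le_sum) auto
  \<comment> \<open>Weighted arithmetic-geometric mean inequality. The weights match because
    \<open>C * \<delta> = 1\<close>, which is how \<open>C\<close> was chosen.\<close>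
  moreover have "a * b \<le> C * a\<^sup>2 / 2 + \<delta> * b\<^sup>2 / 2"
  proof -
    have "0 \<le> (a - \<delta> * b)\<^sup>2 / \<delta>" using \<delta> by simp
    also have "\<dots> = C * a\<^sup>2 - 2 * (a * b) + \<delta> * b\<^sup>2"
      using \<delta> by (simp add: power2_eq_square field_simps)
    finally show ?thesis by simp
  qed
  moreover have "P - r * E \<le> - \<delta> * E" using P_le by (simp add: \<delta>_def algebra_simps)
  moreover have "\<delta> * b\<^sup>2 \<le> \<delta> * E" using \<open>b\<^sup>2 \<le> E\<close> \<delta> by simp
  ultimately have le: "(Re (u 1 * cnj (u 0)) - r * (cmod (u 1))\<^sup>2) + (Re (w 1 * cnj (u 1)) + P - r * E)
      \<le> - (C / 2 + r) * a\<^sup>2 - \<delta> / 2 * E"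
    unfolding a_def[symmetric] by (simp add: algebra_simps)
  have E_nonneg: "E \<ge> 0" unfolding E_def by (intro sum_nonneg) auto
  have not_both: "\<not> (a = 0 \<and> E = 0)"
  proof
    assume "a = 0 \<and> E = 0"
    then have "u 1 = 0" "\<forall>i\<in>{1..n}. w i = 0"
      by (auto simp: a_def E_def sum_nonneg_eq_0_iff)
    then have "u 1 = 0" "u 0 = 0" "\<And>i. i \<in> {1..n} \<Longrightarrow> u (Suc i) = 0"
      using u0 by (auto simp: w_def split: if_splits)
    have "u p = 0" if "p \<le> n + 2" for p
    proof -
      have "p = 0 \<or> p = 1 \<or> p = Suc (Suc n) \<or> (\<exists>i\<in>{1..n}. p = Suc i)"
        using that by (cases p) (auto simp: le_Suc_eq)
      then show ?thesis
        using \<open>u 1 = 0\<close> \<open>u 0 = 0\<close> u_top \<open>\<And>i. i \<in> {1..n} \<Longrightarrow> u (Suc i) = 0\<close> by metis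
    qed
    then show False using nz x_u by auto
  qed
  have "0 < (C / 2 + r) * a\<^sup>2 + \<delta> / 2 * E"
  proof (cases "a = 0")
    case True
    with not_both E_nonneg have "0 < E" by auto
    then show ?thesis using True \<delta>(1) by simp
  next
    case False
    then have "0 < (C / 2 + r) * a\<^sup>2" using \<delta> r_pos by (intro mult_pos_pos add_pos_pos) auto
    moreover have "0 \<le> \<delta> / 2 * E" using \<delta>(1) E_nonneg by simp
    ultimately show ?thesis by linarith
  qed
  with le have "(Re (u 1 * cnj (u 0)) - r * (cmod (u 1))\<^sup>2) + (Re (w 1 * cnj (u 1)) + P - r * E) < 0"
    by linarith
  then show ?thesis unfolding form using r_pos by (simp only: mult_pos_neg)
qed

end

section \<open>The index of a modulus and the data for one eigenvalue\<close>

text \<open>The half-open intervals are disjoint and cover (0, 1], since the last angle is at least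
  pi/2 when \<open>3 \<le> m\<close>. The default value 1 thus concerns only r > 1, where it obeys
  the same bounds as a genuine index.\<close>

lemma kms_index_bounds:
  assumes m: "3 \<le> m" and r: "0 < r"
  shows "1 \<le> kms_index m r" "kms_index m r \<le> m - 2"
    "cos (real (kms_index m r) * pi / (real m - 1)) < r"
    "\<And>l. l \<in> {1..<kms_index m r} \<Longrightarrow> r \<le> cos (real l * pi / (real m - 1))"
proof -
  define c where "c l = cos (real l * pi / (real m - 1))" for l
  define K where "K = {k \<in> {1..m - 2}. cos (real k * pi / (real m - 1)) < r \<and>
    r \<le> cos ((real k - 1) * pi / (real m - 1))}"
  have mono: "c l' \<le> c l" if "l \<le> l'" "l' \<le> m - 1" for l l'
  proof -
    have "real l' * pi \<le> (real m - 1) * pi" using that m by (intro mult_right_mono) auto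
    then have "real l' * pi / (real m - 1) \<le> pi" using m by (simp add: pos_divide_le_eq mult.commute)
    then show ?thesis unfolding c_def using that m
      by (intro cos_monotone_0_pi_le) (auto intro!: divide_right_mono mult_right_mono)
  qed
  have c_last: "c (m - 2) < r"
  proof -
    have "(real m - 1) / 2 * pi \<le> real (m - 2) * pi"
      using m by (intro mult_right_mono) (auto simp: of_nat_diff)
    then have "(real m - 1) * (pi / 2) \<le> real (m - 2) * pi" by simp
    then have 1: "pi / 2 \<le> real (m - 2) * pi / (real m - 1)"
      using m by (simp add: pos_le_divide_eq mult.commute)
    have "real (m - 2) * pi \<le> (real m - 1) * pi" using m by (intro mult_right_mono) auto
    then have "real (m - 2) * pi / (real m - 1) \<le> pi" using m by (simp add: pos_divide_le_eq mult.commute)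
    with 1 have "c (m - 2) \<le> cos (pi / 2)"
      unfolding c_def by (intro cos_monotone_0_pi_le) auto
    then show ?thesis using r by simp
  qed
  have fin: "finite K" by (simp add: K_def)
  have idx: "kms_index m r = (if K = {} then 1 else Max K)"
    unfolding kms_index_def K_def Let_def by (rule refl)
  have KI: "k \<in> K" if "k \<in> {1..m - 2}" "c k < r" "r \<le> c (k - 1)" for k
    using that by (auto simp: K_def c_def of_nat_diff)
  have "1 \<le> kms_index m r \<and> kms_index m r \<le> m - 2 \<and> c (kms_index m r) < r
    \<and> (\<forall>l\<in>{1..<kms_index m r}. r \<le> c l)"
  proof (cases "K = {}")
    case True
    \<comment> \<open>Otherwise take the largest \<open>l\<close> with \<open>r \<le> c l\<close>.
      By \<open>c_last\<close> it is below \<open>m - 2\<close>, and its successor would belong to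
      the empty set \<open>K\<close>.\<close>
    have "c 1 < r"
    proof (rule ccontr)
      assume "\<not> c 1 < r"
      define L where "L = {l \<in> {1..m - 2}. r \<le> c l}"
      have L: "finite L" "1 \<in> L" using \<open>\<not> c 1 < r\<close> m by (auto simp: L_def)
      then have "Max L \<in> L" using Max_in by blast
      then have l: "1 \<le> Max L" "Max L \<le> m - 2" "r \<le> c (Max L)" by (auto simp: L_def)
      then have "Max L \<noteq> m - 2" using c_last by auto
      then have "Suc (Max L) \<in> {1..m - 2}" using l by auto
      moreover have "Suc (Max L) \<notin> L" using Max_ge[OF L(1)] by (metis Suc_n_not_le_n)
      ultimately have "Suc (Max L) \<in> K" using l by (intro KI) (auto simp: L_def)
      then show False using True by simp
    qed
    then show ?thesis using True m by (simp add: idx)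
  next
    case False
    then have "kms_index m r \<in> K" using Max_in[OF fin] by (simp add: idx)
    then have *: "1 \<le> kms_index m r" "kms_index m r \<le> m - 2" "c (kms_index m r) < r"
      "r \<le> c (kms_index m r - 1)" by (auto simp: K_def c_def of_nat_diff)
    have "r \<le> c l" if "l \<in> {1..<kms_index m r}" for l
    proof -
      have "c (kms_index m r - 1) \<le> c l" using that *(2) by (intro mono) auto
      then show ?thesis using *(4) by simp
    qed
    then show ?thesis using * by blast
  qed
  then show "1 \<le> kms_index m r" "kms_index m r \<le> m - 2"
    "cos (real (kms_index m r) * pi / (real m - 1)) < r"
    "\<And>l. l \<in> {1..<kms_index m r} \<Longrightarrow> r \<le> cos (real l * pi / (real m - 1))"
    by (auto simp: c_def)
qed

text \<open>Packages both halves for one eigenvalue. The upper half is kept as negativity on the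
  common kernel of the \<open>f l\<close>, not as a dimension bound, because only this form survives
  direct sums.\<close>

lemma kms_form_scalar:
  assumes m: "3 \<le> m" and d: "d \<noteq> 0"
  obtains z f where
    "lin_indep m {..<kms_index m (cmod d)} z"
    "\<And>a b. a < kms_index m (cmod d) \<Longrightarrow> b < kms_index m (cmod d) \<Longrightarrow> kms_form m d (z a) (z b) = 0"
    "\<And>x. (\<And>l. l < kms_index m (cmod d) \<Longrightarrow> (\<Sum>q<m. f l q * x q) = 0) \<Longrightarrow>
      (\<exists>q<m. x q \<noteq> 0) \<Longrightarrow> Re (kms_form m d x x) < 0"
proof -
  define r where "r = cmod d"
  define k where "k = kms_index m r"
  define n where "n = m - 2"
  have r: "0 < r" using d by (simp add: r_def)
  have m_n: "m = n + 2" "real m - 1 = real n + 1" using m by (auto simp: n_def of_nat_diff)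
  note idx = kms_index_bounds[OF m r, folded k_def, unfolded m_n(2)]
  interpret kms_scalar n k r using idx(1,2) r by unfold_locales (auto simp: n_def)
  have lo: "\<And>l. l \<in> {1..<k} \<Longrightarrow> r \<le> angle_cos l" and up: "angle_cos k < r"
    using idx(3,4) by (auto simp: angle_cos_def)
  define c where "c = d / of_real r"
  have d_eq: "d = of_real r * c" using r by (simp add: c_def)
  have cc: "c * cnj c = 1"
  proof -
    have "cmod c = 1" using r by (simp add: c_def r_def norm_divide)
    then show ?thesis by (simp add: complex_norm_square[symmetric])
  qed
  then have c_nz: "c \<noteq> 0" by auto
  have ccj: "c ^ j * (cnj c ^ j * y) = y" for j and y
    by (simp add: mult.assoc[symmetric] power_mult_distrib[symmetric] cc)
  \<comment> \<open>The factors \<open>cnj c ^ j\<close> undo the diagonal phase on the isotropic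
    vectors; the factors \<open>c ^ q\<close> compose the functionals with it.\<close>
  show thesis
  proof (rule that[of "\<lambda>l j. cnj c ^ j * isotropic_vec l j" "\<lambda>l q. upper_functional l q * c ^ q"], unfold r_def[symmetric] k_def[symmetric])
    show "lin_indep m {..<k} (\<lambda>l j. cnj c ^ j * isotropic_vec l j)"
      unfolding lin_indep_def
    proof (intro allI impI)
      fix e assume e: "\<forall>p<m. (\<Sum>l<k. e l * (cnj c ^ p * isotropic_vec l p)) = 0"
      have "(\<Sum>l<k. e l * isotropic_vec l p) = 0" if "p < n + 2" for p
      proof -
        have "cnj c ^ p * (\<Sum>l<k. e l * isotropic_vec l p) = (\<Sum>l<k. e l * (cnj c ^ p * isotropic_vec l p))"
          by (simp add: sum_distrib_left mult_ac)
        also have "\<dots> = 0" using e that m_n by simp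
        finally show ?thesis using c_nz by simp
      qed
      then show "\<forall>l\<in>{..<k}. e l = 0" using lin_indep_isotropic_vec[OF lo] unfolding lin_indep_def by blast
    qed
    show "kms_form m d (\<lambda>j. cnj c ^ j * isotropic_vec a j) (\<lambda>j. cnj c ^ j * isotropic_vec b j) = 0" if "a < k" "b < k" for a b
      unfolding d_eq kms_form_phase[OF cc] ccj m_n(1) by (rule kms_form_isotropic_vec[OF lo that])
    show "Re (kms_form m d x x) < 0"
      if "\<And>l. l < k \<Longrightarrow> (\<Sum>q<m. upper_functional l q * c ^ q * x q) = 0" "\<exists>q<m. x q \<noteq> 0" for x
    proof -
      have "Re (kms_form (n + 2) (of_real r) (\<lambda>j. c ^ j * x j) (\<lambda>j. c ^ j * x j)) < 0"
      proof (rule Re_kms_form_neg[OF up])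
        show "\<exists>q<n + 2. c ^ q * x q \<noteq> 0" using that(2) c_nz m_n by auto
        show "(\<Sum>q<n + 2. upper_functional l q * (c ^ q * x q)) = 0" if "l < k" for l
          using \<open>\<And>l. l < k \<Longrightarrow> (\<Sum>q<m. upper_functional l q * c ^ q * x q) = 0\<close>[OF that] m_n
          by (simp add: mult.assoc)
      qed
      then show ?thesis unfolding d_eq kms_form_phase[OF cc] m_n(1) .
    qed
  qed
qed

section \<open>The form of a KMS matrix in an eigenbasis\<close>

text \<open>Equal products of monic linear factors have the same multiset of roots, so the order in
  which eigenvalues are listed does not affect the sum.\<close>

lemma sum_eq_of_prod_linear_factors_eq:
  fixes f :: "'a \<Rightarrow> 'c::idom" and h :: "'b \<Rightarrow> 'c" and g :: "'c \<Rightarrow> nat"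
  assumes "finite A" "finite B" "(\<Prod>a\<in>A. [:- f a, 1:]) = (\<Prod>b\<in>B. [:- h b, 1:])"
  shows "(\<Sum>a\<in>A. g (f a)) = (\<Sum>b\<in>B. g (h b))"
proof -
  have roots: "(\<Sum>x\<in>#proots (\<Prod>a\<in>A. [:- f a, 1:]). g x) = (\<Sum>a\<in>A. g (f a))"
    if "finite A" for A and f :: "'d \<Rightarrow> 'c"
    using that
  proof (induction A rule: finite_induct)
    case (insert a A)
    have "(\<Prod>a\<in>A. [:- f a, 1:]) \<noteq> 0" using insert.hyps by (simp add: prod_zero_iff)
    then have "proots (\<Prod>a\<in>insert a A. [:- f a, 1:]) = {#f a#} + proots (\<Prod>a\<in>A. [:- f a, 1:])"
      using insert.hyps by (subst prod.insert) (simp_all add: proots_mult del: mult_pCons_left)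
    then show ?case using insert by simp
  qed simp
  show ?thesis using roots[OF assms(1), of f] roots[OF assms(2), of h] assms(3) by simp
qed

lemma sum_blocks: "(\<Sum>p<m * n. f p) = (\<Sum>i<m. \<Sum>b<n. f (i * n + b))" for f :: "nat \<Rightarrow> 'a::comm_monoid_add"
proof -
  have "(\<Sum>p=a..<a + k. f p) = (\<Sum>b<k. f (a + b))" for a k :: nat
    by (induction k) auto
  then show ?thesis by (simp flip: sum.nat_group)
qed

lemma block_index_less:
  assumes "i < m" "b < (n :: nat)"
  shows "i * n + b < m * n"
proof -
  have "i * n + b < Suc i * n" using assms by simp
  also have "\<dots> \<le> m * n" using assms by (intro mult_le_mono1) simp
  finally show ?thesis .
qed

text \<open>Block \<open>i\<close> of \<open>x\<close> tested against \<open>v\<close>. For an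
  orthonormal basis of vectors \<open>v\<close> this splits a vector of length m n into n sequences
  of length m.\<close>

definition eigen_component :: "nat \<Rightarrow> (nat \<Rightarrow> complex) \<Rightarrow> (nat \<Rightarrow> complex) \<Rightarrow> nat \<Rightarrow> complex" where
  "eigen_component n v x i = (\<Sum>b<n. cnj (v b) * x (i * n + b))"

lemma eigen_component_sum:
  "eigen_component n v (\<lambda>p. \<Sum>t\<in>I. c t * w t p) i = (\<Sum>t\<in>I. c t * eigen_component n v (w t) i)"
proof -
  have "eigen_component n v (\<lambda>p. \<Sum>t\<in>I. c t * w t p) i
      = (\<Sum>b<n. \<Sum>t\<in>I. c t * (cnj (v b) * w t (i * n + b)))"
    by (simp add: eigen_component_def sum_distrib_left mult_ac)
  also have "\<dots> = (\<Sum>t\<in>I. \<Sum>b<n. c t * (cnj (v b) * w t (i * n + b)))" by (rule sum.swap)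
  finally show ?thesis by (simp add: eigen_component_def sum_distrib_left)
qed

lemma eigen_component_expand:
  assumes q: "orthonormal_fam n n q" and "b < n"
  shows "x (i * n + b) = (\<Sum>a<n. eigen_component n (q a) x i * q a b)"
  unfolding eigen_component_def mult.commute[of "cnj _"]
  by (rule orthonormal_fam_expand[OF q \<open>b < n\<close>, of "\<lambda>b. x (i * n + b)", unfolded hinner_def])

text \<open>Inserting the spectral decomposition of \<open>A ^\<^sub>m (j - i)\<close> into each
  block decouples the eigenvectors: up to a unitary change of basis the matrix is the direct sum of
  the scalar KMS matrices.\<close>

lemma sform_kms_mat:
  assumes A: "A \<in> carrier_mat n n" and q: "orthonormal_fam n n q"
    and d: "\<And>a p. a < n \<Longrightarrow> p < n \<Longrightarrow> mat_apply n A (q a) p = d a * q a p"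
  shows "sform (m * n) (kms_mat m A) x y
    = (\<Sum>a<n. kms_form m (d a) (eigen_component n (q a) x) (eigen_component n (q a) y))"
proof -
  let ?K = "kms_mat m A" and ?X = "\<lambda>a. eigen_component n (q a) x" and ?Y = "\<lambda>a. eigen_component n (q a) y"
  have entry: "?K $$ (i * n + b, j * n + b')
      = (if i < j then \<Sum>a<n. q a b * d a ^ (j - i) * cnj (q a b') else 0)"
    if "i < m" "j < m" "b < n" "b' < n" for i j b b'
    using that A block_index_less[of i m b n] block_index_less[of j m b' n]
    by (auto simp: kms_mat_def Let_def eigenbasis_pow_index[OF A q d])
  have block: "(\<Sum>b<n. \<Sum>b'<n. cnj (y (i * n + b)) * ?K $$ (i * n + b, j * n + b') * x (j * n + b'))
      = (\<Sum>a<n. if i < j then d a ^ (j - i) * ?X a j * cnj (?Y a i) else 0)" if ij: "i < m" "j < m" for i j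
  proof (cases "i < j")
    case True
    have "(\<Sum>b<n. \<Sum>b'<n. cnj (y (i * n + b)) * ?K $$ (i * n + b, j * n + b') * x (j * n + b'))
      = (\<Sum>b<n. \<Sum>b'<n. \<Sum>a<n. d a ^ (j - i) * ((cnj (q a b') * x (j * n + b')) * (q a b * cnj (y (i * n + b)))))"
      using ij True by (intro sum.cong refl) (simp add: entry sum_distrib_left sum_distrib_right mult_ac)
    also have "\<dots> = (\<Sum>b<n. \<Sum>a<n. \<Sum>b'<n. d a ^ (j - i) * ((cnj (q a b') * x (j * n + b')) * (q a b * cnj (y (i * n + b)))))"
      by (intro sum.cong refl sum.swap)
    also have "\<dots> = (\<Sum>a<n. \<Sum>b<n. \<Sum>b'<n. d a ^ (j - i) * ((cnj (q a b') * x (j * n + b')) * (q a b * cnj (y (i * n + b)))))"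
      by (rule sum.swap)
    also have "\<dots> = (\<Sum>a<n. d a ^ (j - i) * ((\<Sum>b'<n. cnj (q a b') * x (j * n + b'))
        * (\<Sum>b<n. q a b * cnj (y (i * n + b)))))"
      unfolding sum_product unfolding sum_distrib_left by (intro sum.cong refl sum.swap)
    also have "\<dots> = (\<Sum>a<n. d a ^ (j - i) * ?X a j * cnj (?Y a i))"
      by (simp add: eigen_component_def mult.assoc)
    finally show ?thesis using True by simp
  next
    case False
    then show ?thesis using ij by (simp add: entry)
  qed
  have "sform (m * n) ?K x y = (\<Sum>i<m. \<Sum>b<n. \<Sum>j<m. \<Sum>b'<n.
      cnj (y (i * n + b)) * ?K $$ (i * n + b, j * n + b') * x (j * n + b'))"
    by (simp only: sform_def sum_blocks)
  also have "\<dots> = (\<Sum>i<m. \<Sum>j<m. \<Sum>b<n. \<Sum>b'<n.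
      cnj (y (i * n + b)) * ?K $$ (i * n + b, j * n + b') * x (j * n + b'))"
    by (intro sum.cong refl sum.swap)
  also have "\<dots> = (\<Sum>i<m. \<Sum>j<m. \<Sum>a<n. if i < j then d a ^ (j - i) * ?X a j * cnj (?Y a i) else 0)"
    by (rule sum.cong[OF refl], rule sum.cong[OF refl]) (simp add: block)
  also have "\<dots> = (\<Sum>i<m. \<Sum>a<n. \<Sum>j<m. if i < j then d a ^ (j - i) * ?X a j * cnj (?Y a i) else 0)"
    by (intro sum.cong refl sum.swap)
  also have "\<dots> = (\<Sum>a<n. \<Sum>i<m. \<Sum>j<m. if i < j then d a ^ (j - i) * ?X a j * cnj (?Y a i) else 0)"
    by (rule sum.swap)
  finally show ?thesis by (simp only: kms_form_def)
qed

lemma kms_form_zero_left: "(\<And>j. j < m \<Longrightarrow> x j = 0) \<Longrightarrow> kms_form m d x y = 0"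
  unfolding kms_form_def by (intro sum.neutral ballI) auto

lemma kms_form_zero_right: "(\<And>j. j < m \<Longrightarrow> y j = 0) \<Longrightarrow> kms_form m d x y = 0"
  unfolding kms_form_def by (intro sum.neutral ballI) auto

lemma kms_form_cong:
  "(\<And>j. j < m \<Longrightarrow> x j = x' j) \<Longrightarrow> (\<And>j. j < m \<Longrightarrow> y j = y' j) \<Longrightarrow> kms_form m d x y = kms_form m d x' y'"
  unfolding kms_form_def by (intro sum.cong) auto

lemma invertible_eigenvalue_nonzero:
  assumes A: "A \<in> carrier_mat n n" and inv: "invertible_mat A"
    and v: "\<And>p. p < n \<Longrightarrow> mat_apply n A v p = l * v p" "hinner n v v = 1"
  shows "l \<noteq> 0"
proof
  assume "l = 0"
  obtain B where B: "A * B = 1\<^sub>m n" "B * A = 1\<^sub>m (dim_row B)"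
    using inv A by (auto simp: invertible_mat_def inverts_mat_def)
  have "dim_col (B * A) = n" using A by simp
  then have "dim_row B = n" unfolding B by simp
  moreover have "dim_col (A * B) = n" unfolding B by simp
  ultimately have Bc: "B \<in> carrier_mat n n" by auto
  have "v p = 0" if "p < n" for p
  proof -
    have "v p = (\<Sum>r<n. if r = p then v r else 0)" using that by (simp add: sum.delta)
    also have "\<dots> = mat_apply n (B * A) v p"
      unfolding B \<open>dim_row B = n\<close> mat_apply_def using that by (intro sum.cong) auto
    also have "\<dots> = mat_apply n B (mat_apply n A v) p" by (rule mat_apply_mult[OF Bc A that])
    also have "\<dots> = 0" unfolding mat_apply_def[of n B] using v(1) \<open>l = 0\<close> by simp
    finally show ?thesis .
  qed
  then have "hinner n v v = 0" by (simp add: hinner_def)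
  with v(2) show False by simp
qed

theorem corollary4p16:
  fixes m n :: nat and A :: "complex mat" and ev :: "nat \<Rightarrow> complex"
  assumes "3 \<le> m" and "1 \<le> n"
    and "A \<in> carrier_mat n n"
    and "invertible_mat A"
    and "normal_mat A"
    and "char_poly A = (\<Prod>i = 1..n. [:- ev i, 1:])"
  shows "zero_dilation_index (kms_mat m A) = (\<Sum>i = 1..n. kms_index m (cmod (ev i)))"
proof -
  note A = assms(3)
  obtain q d where q: "orthonormal_fam n n q"
    and d: "\<And>a p. a < n \<Longrightarrow> p < n \<Longrightarrow> mat_apply n A (q a) p = d a * q a p"
    using normal_mat_eigenbasis[OF A assms(5)] by blast
  have d_nz: "d a \<noteq> 0" if "a < n" for a
    using q that by (intro invertible_eigenvalue_nonzero[OF A assms(4), of "q a"])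
      (auto simp: d orthonormal_fam_def)
  let ?k = "\<lambda>a. kms_index m (cmod (d a))"
  define scalar where "scalar a z f \<longleftrightarrow> lin_indep m {..<?k a} z \<and>
      (\<forall>i<?k a. \<forall>j<?k a. kms_form m (d a) (z i) (z j) = 0) \<and>
      (\<forall>x. (\<forall>l<?k a. (\<Sum>p<m. f l p * x p) = 0) \<longrightarrow> (\<exists>p<m. x p \<noteq> 0) \<longrightarrow>
        Re (kms_form m (d a) x x) < 0)"
    for a and z f :: "nat \<Rightarrow> nat \<Rightarrow> complex"
  have "\<exists>z f. a < n \<longrightarrow> scalar a z f" for a
  proof (cases "a < n")
    case True
    show ?thesis
    proof (rule kms_form_scalar[OF assms(1) d_nz[OF True]])
      fix z f
      assume "lin_indep m {..<?k a} z"
        "\<And>i j. i < ?k a \<Longrightarrow> j < ?k a \<Longrightarrow> kms_form m (d a) (z i) (z j) = 0"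
        "\<And>x. (\<And>l. l < ?k a \<Longrightarrow> (\<Sum>p<m. f l p * x p) = 0) \<Longrightarrow> (\<exists>p<m. x p \<noteq> 0) \<Longrightarrow>
          Re (kms_form m (d a) x x) < 0"
      then have "scalar a z f" unfolding scalar_def by blast
      then show ?thesis by blast
    qed
  qed auto
  then obtain z f where scalar: "\<And>a. a < n \<Longrightarrow> scalar a (z a) (f a)" by metis
  define I where "I = Sigma {..<n} (\<lambda>a. {..<?k a})"
  have I: "finite I" "card I = (\<Sum>a<n. ?k a)" by (auto simp: I_def card_SigmaI)
  \<comment> \<open>The tensor product of the scalar isotropic vector with its eigenvector: the
    block number is \<open>p div n\<close>, the position inside the block
    \<open>p mod n\<close>.\<close>
  define w where "w t p = q (fst t) (p mod n) * z (fst t) (snd t) (p div n)" for t p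
  let ?N = "m * n" and ?X = "kms_mat m A" and ?E = "\<lambda>a. eigen_component n (q a)"
  have form: "sform ?N ?X x y = (\<Sum>a<n. kms_form m (d a) (?E a x) (?E a y))" for x y
    by (rule sform_kms_mat[OF A q d])
  have comp: "?E a (w t) i = (if fst t = a then z a (snd t) i else 0)" if "a < n" "t \<in> I" for a t i
  proof -
    have "?E a (w t) i = hinner n (q (fst t)) (q a) * z (fst t) (snd t) i"
      unfolding eigen_component_def w_def hinner_def sum_distrib_right
      by (intro sum.cong) auto
    then show ?thesis using q that by (auto simp: orthonormal_fam_def I_def)
  qed
  have "zero_dilation_index ?X = card I"
  proof (rule zero_dilation_index_eqI)
    show "?X \<in> carrier_mat ?N ?N" using A by (simp add: kms_mat_def Let_def)
    show "finite I" by (fact I)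
    show "lin_indep ?N I w" unfolding lin_indep_def
    proof (intro allI impI ballI)
      fix c t assume c: "\<forall>p<?N. (\<Sum>t\<in>I. c t * w t p) = 0" and t: "t \<in> I"
      define a where "a = fst t"
      have a: "a < n" "snd t < ?k a" using t by (auto simp: I_def a_def)
      have "\<forall>i<m. (\<Sum>l<?k a. c (a, l) * z a l i) = 0"
      proof (intro allI impI)
        fix i assume "i < m"
        have "0 = ?E a (\<lambda>p. \<Sum>t\<in>I. c t * w t p) i"
          unfolding eigen_component_def using c block_index_less[OF \<open>i < m\<close>]
          by (intro sum.neutral[symmetric]) auto
        also have "\<dots> = (\<Sum>t\<in>I. c t * (if fst t = a then z a (snd t) i else 0))"
          unfolding eigen_component_sum by (intro sum.cong refl) (simp add: comp a)
        also have "\<dots> = (\<Sum>t\<in>Pair a ` {..<?k a}. c t * (if fst t = a then z a (snd t) i else 0))"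
          using a I(1) by (intro sum.mono_neutral_right) (auto simp: I_def)
        also have "\<dots> = (\<Sum>l<?k a. c (a, l) * z a l i)"
          by (subst sum.reindex) (auto simp: inj_on_def)
        finally show "(\<Sum>l<?k a. c (a, l) * z a l i) = 0" by simp
      qed
      moreover have "lin_indep m {..<?k a} (z a)" using scalar[OF a(1)] by (simp add: scalar_def)
      ultimately have "\<forall>l\<in>{..<?k a}. c (a, l) = 0"
        unfolding lin_indep_def by (elim allE[of _ "\<lambda>l. c (a, l)"]) auto
      then have "c (a, snd t) = 0" using a(2) by simp
      then show "c t = 0" by (simp add: a_def)
    qed
    show "sform ?N ?X (w s) (w t) = 0" if "s \<in> I" "t \<in> I" for s t
      unfolding form
    proof (intro sum.neutral ballI)
      fix a assume "a \<in> {..<n}"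
      then have a: "a < n" by simp
      note comp' = comp[OF a that(1)] comp[OF a that(2)]
      consider "fst s \<noteq> a" | "fst t \<noteq> a" | "fst s = a" "fst t = a" by blast
      then show "kms_form m (d a) (?E a (w s)) (?E a (w t)) = 0"
      proof cases
        case 1
        then show ?thesis by (intro kms_form_zero_left) (simp add: comp')
      next
        case 2
        then show ?thesis by (intro kms_form_zero_right) (simp add: comp')
      next
        case 3
        then have "kms_form m (d a) (?E a (w s)) (?E a (w t)) = kms_form m (d a) (z a (snd s)) (z a (snd t))"
          by (intro kms_form_cong) (simp_all add: comp')
        also have "\<dots> = 0" using scalar[OF a] that 3 by (auto simp: scalar_def I_def)
        finally show ?thesis .
      qed
    qed
    fix K :: nat and v
    assume v: "lin_indep ?N {..<K} v" "\<And>a b. a < K \<Longrightarrow> b < K \<Longrightarrow> sform ?N ?X (v a) (v b) = 0"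
    show "K \<le> card I"
    proof (rule ccontr)
      assume "\<not> K \<le> card I"
      then have "card I < card {..<K}" by simp
      \<comment> \<open>Each pair in \<open>I\<close> gives one equation on the coefficients: the
        functional \<open>f\<close> applied to the matching eigen component must vanish. An
        isotropic family larger than \<open>I\<close> leaves a nontrivial solution.\<close>
      from homogeneous_system[OF I(1) _ this, of "\<lambda>t i. \<Sum>p<m. f (fst t) (snd t) p * ?E (fst t) (v i) p"]
      obtain c where c: "\<exists>i<K. c i \<noteq> 0"
        "\<And>t. t \<in> I \<Longrightarrow> (\<Sum>i<K. (\<Sum>p<m. f (fst t) (snd t) p * ?E (fst t) (v i) p) * c i) = 0" by auto
      define x where "x = (\<lambda>p. \<Sum>i<K. c i * v i p)"
      have zero: "sform ?N ?X x x = 0"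
        unfolding x_def sform_sum_left sform_sum_right by (simp add: v(2))
      have ortho: "(\<Sum>p<m. f a l p * ?E a x p) = 0" if "a < n" "l < ?k a" for a l
      proof -
        have "(\<Sum>p<m. f a l p * ?E a x p) = (\<Sum>p<m. \<Sum>i<K. f a l p * ?E a (v i) p * c i)"
          unfolding x_def eigen_component_sum by (simp add: sum_distrib_left mult_ac)
        also have "\<dots> = (\<Sum>i<K. (\<Sum>p<m. f a l p * ?E a (v i) p) * c i)"
          unfolding sum_distrib_right by (rule sum.swap)
        also have "\<dots> = 0" using c(2)[of "(a, l)"] that by (simp add: I_def)
        finally show ?thesis .
      qed
      have neg: "Re (kms_form m (d a) (?E a x) (?E a x)) < 0" if "a < n" "\<exists>i<m. ?E a x i \<noteq> 0" for a
        using scalar[OF that(1)] ortho[OF that(1)] that(2) unfolding scalar_def by blast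
      have "Re (kms_form m (d a) (?E a x) (?E a x)) \<le> 0" if "a < n" for a
      proof (cases "\<exists>i<m. ?E a x i \<noteq> 0")
        case True
        then show ?thesis using neg[OF that] by simp
      next
        case False
        then have "kms_form m (d a) (?E a x) (?E a x) = 0" by (intro kms_form_zero_left) auto
        then show ?thesis by simp
      qed
      moreover have "\<exists>a<n. \<exists>i<m. ?E a x i \<noteq> 0"
      proof (rule ccontr)
        assume no: "\<not> (\<exists>a<n. \<exists>i<m. ?E a x i \<noteq> 0)"
        have "x p = 0" if "p < ?N" for p
        proof -
          have "p div n < m" using that by (simp add: less_mult_imp_div_less)
          then have "x (p div n * n + p mod n) = 0"
            using eigen_component_expand[OF q, of "p mod n" x "p div n"] no assms(2) by auto
          then show ?thesis by simp
        qed
        then have "\<forall>i\<in>{..<K}. c i = 0" using v(1) unfolding lin_indep_def x_def by blast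
        then show False using c(1) by auto
      qed
      \<comment> \<open>No cancellation is possible: all summands are at most zero, and one is
        negative because \<open>x\<close> has a nonzero component.\<close>
      ultimately have "(\<Sum>a<n. Re (kms_form m (d a) (?E a x) (?E a x))) < (\<Sum>a<n. 0)"
        using neg by (intro sum_strict_mono_ex1) auto
      also have "(\<Sum>a<n. Re (kms_form m (d a) (?E a x) (?E a x))) = Re (sform ?N ?X x x)"
        unfolding form by simp
      finally show False using zero by simp
    qed
  qed
  \<comment> \<open>Passes from the eigenvalues \<open>d\<close> of the chosen basis to the given
    list \<open>ev\<close> by comparing characteristic polynomials.\<close>
  also have "card I = (\<Sum>i = 1..n. kms_index m (cmod (ev i)))"
    unfolding I(2)
    by (rule sum_eq_of_prod_linear_factors_eq[where g = "\<lambda>x. kms_index m (cmod x)"])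
      (use eigenbasis_char_poly[OF A q d] assms(6) in auto)
  finally show ?thesis .
qed

end
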